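(* For all integers $i,j\ge 1$, the number of fighting fish with $i$ free left lower edges and $j$ free right lower edges is $$\frac{(2i+j-2)!\,(2j+i-2)!}{i!\,j!\,(2i-1)!\,(2j-1)!}=\frac{1}{ij}\binom{2i+j-2}{j-1}\binom{2j+i-2}{i-1}.$$
   Context: A cell is a unit square rotated by 45 degrees; its four edges are called its left upper, left lower, right upper and right lower edges. Cells are glued edge to edge; an edge of a cell is free if it is not glued to an edge of another cell. A fighting fish is a collection of cells glued along edges that can be obtained from a single initial cell (the head) by repeatedly applying one of the following operations: (i) if a cell $a$ has a free right upper edge, glue the left lower edge of a new cell to it; (ii) if a cell $a$ has a free right lower edge, glue the left upper edge of a new cell to it; (iii) if cells $a,b,c$ are such that the left lower edge of $b$ is glued to the right upper edge of $a$, the left upper edge of $c$ is glued to the right lower edge of $a$, and the right lower edge of $b$ and the right upper edge of $c$ are free, glue simultaneously the left upper edge of a new cell $d$ to the right lower edge of $b$ and the left lower edge of $d$ to the right upper edge of $c$. A fighting fish is the resulting glued object, independent of the order of construction (cells need not fit in the plane; their projections may overlap). *)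

theory Defs
  imports Complex_Main
begin

text \<open>A (labelled) fighting fish with n cells: cells are 0..<n, cell 0 is the head.
  U x = Some y : the right upper edge of x is glued to the left lower edge of y.
  D x = Some y : the right lower edge of x is glued to the left upper edge of y.
  These are all the gluings (every gluing joins a right edge to a left edge).
  Each new cell receives the next free label n.\<close>

inductive fish :: "nat \<Rightarrow> (nat \<Rightarrow> nat option) \<Rightarrow> (nat \<Rightarrow> nat option) \<Rightarrow> bool" where
  head: "fish 1 Map.empty Map.empty"
| op_i: "fish n U D \<Longrightarrow> a < n \<Longrightarrow> U a = None \<Longrightarrow> fish (Suc n) (U(a \<mapsto> n)) D"
| op_ii: "fish n U D \<Longrightarrow> a < n \<Longrightarrow> D a = None \<Longrightarrow> fish (Suc n) U (D(a \<mapsto> n))"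
| op_iii: "fish n U D \<Longrightarrow> a < n \<Longrightarrow> U a = Some b \<Longrightarrow> D a = Some c \<Longrightarrow>
           D b = None \<Longrightarrow> U c = None \<Longrightarrow> fish (Suc n) (U(c \<mapsto> n)) (D(b \<mapsto> n))"

type_synonym fish_rep = "nat \<times> (nat \<Rightarrow> nat option) \<times> (nat \<Rightarrow> nat option)"

definition fish_iso :: "fish_rep \<Rightarrow> fish_rep \<Rightarrow> bool" where
  "fish_iso F G = (case F of (n, U, D) \<Rightarrow> case G of (m, U', D') \<Rightarrow>
     \<exists>f. bij_betw f {0..<n} {0..<m} \<and>
         (\<forall>x<n. U' (f x) = map_option f (U x) \<and> D' (f x) = map_option f (D x)))"

definition fish_iso_rel :: "fish_rep rel" where
  "fish_iso_rel = {(F, G). fish_iso F G}"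

definition free_left_lower :: "fish_rep \<Rightarrow> nat" where
  "free_left_lower F = (case F of (n, U, D) \<Rightarrow> card {x. x < n \<and> (\<forall>y<n. U y \<noteq> Some x)})"

definition free_right_lower :: "fish_rep \<Rightarrow> nat" where
  "free_right_lower F = (case F of (n, U, D) \<Rightarrow> card {x. x < n \<and> D x = None})"

definition fish_reps :: "nat \<Rightarrow> nat \<Rightarrow> fish_rep set" where
  "fish_reps i j = {F. (case F of (n, U, D) \<Rightarrow> fish n U D) \<and>
                       free_left_lower F = i \<and> free_right_lower F = j}"

definition num_fish :: "nat \<Rightarrow> nat \<Rightarrow> nat" where
  "num_fish i j = card (fish_reps i j // fish_iso_rel)"

end

theory Submission
  imports Defs "HOL-Computational_Algebra.Formal_Power_Series"
begin

unbundle fps_syntax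

text \<open>
  Cutting a fish along the row of cells that leaves the head through right lower edges decomposes it
  recursively: the cells of this row that carry something above them fall into groups of consecutive
  cells, and on top of a group of \<open>g\<close> cells sits a smaller fish whose head row has at least \<open>g\<close>
  cells. If \<open>x\<close> marks free left lower edges (equivalently free right upper edges), \<open>y\<close> free right
  lower edges and \<open>u\<close> the length of the head row, then the series \<open>W\<close> of fish, together with an
  empty fish of weight \<open>y\<close>, satisfies
  \<open>(u - 1) (W - y) = W u (x (u - 1) + W - W1)\<close>, where \<open>W1\<close> is \<open>W\<close> at \<open>u = 1\<close>.
  For \<open>x = r (1 - s)^2\<close> and \<open>y = s (1 - r)^2\<close> this equation has a solution that is rational in
  \<open>r\<close>, \<open>s\<close> and one further parameter in place of \<open>u\<close>, with \<open>W1 = s (1 - r - r s)\<close>, and its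
  solution is unique. The coefficients of \<open>W1\<close> in \<open>x\<close> and \<open>y\<close> then follow from a two-variable
  Lagrange inversion.
\<close>

section \<open>Fish and trees\<close>

text \<open>A fish may overlap itself and has many orders of construction, so it is handled through
  local conditions on its gluings and through a tree that is a complete isomorphism invariant. The
  functional equation has two unknowns, \<open>W\<close> and \<open>W1\<close>. As a quadratic in
  \<open>W\<close> its discriminant has degree 4 in \<open>u\<close>; with the stated value of
  \<open>W1\<close> it has the repeated factor \<open>1 - (1 - s) u\<close>, and a quadratic in
  \<open>u\<close> remains, whose square root has a rational parametrization. Such a solution needs
  only verification, because uniqueness identifies it with the fish series. For \<open>r\<close> and
  \<open>s\<close> one variable suffices: \<open>r = \<alpha> z\<close>, \<open>s = z\<close> with
  real \<alpha> turns a coefficient of \<open>z ^ N\<close> into a polynomial in \<alpha> whose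
  coefficients are the sought ones, while the parameter replacing \<open>u\<close> lives in an inner
  layer of series. Lagrange inversion uses no residues but finite sums: an explicit inverse of the
  triangular matrix that expands \<open>x ^ i * y ^ j\<close> in \<open>r\<close> and
  \<open>s\<close>.\<close>

text \<open>\<open>rank\<close> only serves to make the gluing acyclic, and \<open>square\<close> is
  the trace left by operation (iii). The cell type is arbitrary so that the same facts hold for
  numbered cells and for cells named by paths in a tree.\<close>

locale glued_cells =
  fixes C :: "'a set" and U D :: "'a \<Rightarrow> 'a option" and rank :: "'a \<Rightarrow> nat" and h :: 'a
  assumes finite_cells: "finite C"
    and head_cell: "h \<in> C"
    and U_cells: "U x = Some y \<Longrightarrow> x \<in> C \<and> y \<in> C \<and> rank x < rank y"
    and D_cells: "D x = Some y \<Longrightarrow> x \<in> C \<and> y \<in> C \<and> rank x < rank y"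
    and U_inj: "U x = Some y \<Longrightarrow> U x' = Some y \<Longrightarrow> x = x'"
    and D_inj: "D x = Some y \<Longrightarrow> D x' = Some y \<Longrightarrow> x = x'"
    and square: "U c = Some d \<Longrightarrow> D b = Some d \<Longrightarrow> \<exists>a. U a = Some b \<and> D a = Some c"
    and head_not_U: "U x \<noteq> Some h"
    and head_not_D: "D x \<noteq> Some h"
    and has_pred: "y \<in> C \<Longrightarrow> y \<noteq> h \<Longrightarrow> \<exists>x. U x = Some y \<or> D x = Some y"

text \<open>One statement covers all three operations: \<open>P\<close> holds the cell, if any,
  whose right upper edge receives the new cell \<open>n\<close>, and \<open>Q\<close> the cell whose
  right lower edge does.\<close>

lemma glued_cells_extend:
  assumes "glued_cells {0..<n} U D (\<lambda>x. x) 0"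
    and U': "\<And>x y. U' x = Some y \<longleftrightarrow> U x = Some y \<or> y = n \<and> x \<in> P"
    and D': "\<And>x y. D' x = Some y \<longleftrightarrow> D x = Some y \<or> y = n \<and> x \<in> Q"
    and lt: "\<And>x. x \<in> P \<union> Q \<Longrightarrow> x < n"
    and ne: "P \<union> Q \<noteq> {}"
    and P: "\<And>x x'. x \<in> P \<Longrightarrow> x' \<in> P \<Longrightarrow> x = x'"
    and Q: "\<And>x x'. x \<in> Q \<Longrightarrow> x' \<in> Q \<Longrightarrow> x = x'"
    and sq: "\<And>b c. c \<in> P \<Longrightarrow> b \<in> Q \<Longrightarrow> \<exists>a. U a = Some b \<and> D a = Some c"
  shows "glued_cells {0..<Suc n} U' D' (\<lambda>x. x) 0"
proof -
  interpret glued_cells "{0..<n}" U D "\<lambda>x. x" 0 by fact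
  have new: "U x \<noteq> Some n" "D x \<noteq> Some n" for x
    using U_cells[of x n] D_cells[of x n] by auto
  have n: "0 < n" using head_cell by simp
  show ?thesis
  proof unfold_locales
    fix x y assume "U' x = Some y"
    then show "x \<in> {0..<Suc n} \<and> y \<in> {0..<Suc n} \<and> x < y"
      using U' U_cells[of x y] lt by fastforce
  next
    fix x y assume "D' x = Some y"
    then show "x \<in> {0..<Suc n} \<and> y \<in> {0..<Suc n} \<and> x < y"
      using D' D_cells[of x y] lt by fastforce
  next
    fix x y x' assume "U' x = Some y" "U' x' = Some y"
    then show "x = x'" using U' U_inj new P by metis
  next
    fix x y x' assume "D' x = Some y" "D' x' = Some y"
    then show "x = x'" using D' D_inj new Q by metis
  next
    fix c d b assume *: "U' c = Some d" "D' b = Some d"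
    have "\<exists>a. U a = Some b \<and> D a = Some c"
    proof (cases "d = n")
      case True
      then show ?thesis using * U' D' new sq[of c b] by simp
    next
      case False
      then show ?thesis using * U' D' square[of c d b] by simp
    qed
    then show "\<exists>a. U' a = Some b \<and> D' a = Some c" using U' D' by blast
  next
    fix y assume "y \<in> {0..<Suc n}" "y \<noteq> 0"
    then show "\<exists>x. U' x = Some y \<or> D' x = Some y"
      using has_pred[of y] U' D' ne by (cases "y = n") auto
  next
    fix x show "U' x \<noteq> Some 0" "D' x \<noteq> Some 0"
      using U' D' n head_not_U head_not_D by auto
  qed (use n in auto)
qed

lemma fish_imp_glued_cells: "fish n U D \<Longrightarrow> glued_cells {0..<n} U D (\<lambda>x. x) 0"
proof (induction rule: fish.induct)
  case head
  show ?case by unfold_locales auto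
next
  case (op_i n U D a)
  show ?case
    by (rule glued_cells_extend[OF op_i.IH, where P = "{a}" and Q = "{}"]) (use op_i.hyps in auto)
next
  case (op_ii n U D a)
  show ?case
    by (rule glued_cells_extend[OF op_ii.IH, where P = "{}" and Q = "{a}"]) (use op_ii.hyps in auto)
next
  case (op_iii n U D a b c)
  interpret glued_cells "{0..<n}" U D "\<lambda>x. x" 0 by (rule op_iii.IH)
  have "b < n" "c < n"
    using U_cells[OF op_iii.hyps(3)] D_cells[OF op_iii.hyps(4)] by auto
  then show ?case
    by (intro glued_cells_extend[OF op_iii.IH, where P = "{c}" and Q = "{b}"]) (use op_iii.hyps in auto)
qed

text \<open>The labels are an order of construction: the cell with the largest label has nothing
  glued to its right edges, so removing it preserves the conditions, and its one or two predecessors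
  tell which operation glued it.\<close>

lemma glued_cells_imp_fish: "glued_cells {0..<n} U D (\<lambda>x. x) 0 \<Longrightarrow> fish n U D"
proof (induction n arbitrary: U D)
  case 0
  then show ?case using glued_cells.head_cell by fastforce
next
  case (Suc n)
  interpret glued_cells "{0..<Suc n}" U D "\<lambda>x. x" 0 by (rule Suc.prems)
  show ?case
  proof (cases "n = 0")
    case True
    have "U = Map.empty" "D = Map.empty"
      using U_cells D_cells True by (auto simp: fun_eq_iff) (metis atLeastLessThan_iff less_one not_less0 not_None_eq)+
    then show ?thesis using True fish.head by simp
  next
    case False
    have last: "U n = None" "D n = None"
      using U_cells[of n] D_cells[of n] by (cases "U n"; cases "D n"; fastforce)+
    define U' where "U' = (\<lambda>x. if U x = Some n then None else U x)"
    define D' where "D' = (\<lambda>x. if D x = Some n then None else D x)"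
    have U': "U' x = Some y \<longleftrightarrow> U x = Some y \<and> y \<noteq> n" for x y by (auto simp: U'_def)
    have D': "D' x = Some y \<longleftrightarrow> D x = Some y \<and> y \<noteq> n" for x y by (auto simp: D'_def)
    have ltn: "U x = Some y \<Longrightarrow> x < n" "D x = Some y \<Longrightarrow> x < n" for x y
      using U_cells[of x y] D_cells[of x y] by auto
    have "glued_cells {0..<n} U' D' (\<lambda>x. x) 0"
    proof unfold_locales
      fix c d b assume *: "U' c = Some d" "D' b = Some d"
      then obtain a where a: "U a = Some b" "D a = Some c" using square U' D' by blast
      have "b \<noteq> n" "c \<noteq> n" using * U' D' last by auto
      then show "\<exists>a. U' a = Some b \<and> D' a = Some c" using a U' D' by blast
    next
      fix y assume "y \<in> {0..<n}" "y \<noteq> 0"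
      then show "\<exists>x. U' x = Some y \<or> D' x = Some y" using has_pred[of y] U' D' by fastforce
    next
      fix x y assume "U' x = Some y"
      then show "x \<in> {0..<n} \<and> y \<in> {0..<n} \<and> x < y" using U' U_cells[of x y] by fastforce
    next
      fix x y assume "D' x = Some y"
      then show "x \<in> {0..<n} \<and> y \<in> {0..<n} \<and> x < y" using D' D_cells[of x y] by fastforce
    qed (use False U' D' U_inj D_inj head_not_U head_not_D in auto)
    then have F: "fish n U' D'" by (rule Suc.IH)
    have nU: "U' = U" if "\<And>x. U x \<noteq> Some n" using that by (auto simp: U'_def)
    have nD: "D' = D" if "\<And>x. D x \<noteq> Some n" using that by (auto simp: D'_def)
    have yU: "U = U'(c \<mapsto> n)" if "U c = Some n" for c
      using that U_inj by (auto simp: U'_def fun_eq_iff)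
    have yD: "D = D'(b \<mapsto> n)" if "D b = Some n" for b
      using that D_inj by (auto simp: D'_def fun_eq_iff)
    consider (u) c where "U c = Some n" "\<And>x. D x \<noteq> Some n"
      | (d) b where "D b = Some n" "\<And>x. U x \<noteq> Some n"
      | (ud) b c where "D b = Some n" "U c = Some n"
      using has_pred[of n] False by fastforce
    then show ?thesis
    proof cases
      case u
      then have "fish (Suc n) (U'(c \<mapsto> n)) D'"
        using F ltn by (intro fish.op_i) (auto simp: U'_def)
      then show ?thesis unfolding yU[OF u(1), symmetric] nD[OF u(2)] .
    next
      case d
      then have "fish (Suc n) U' (D'(b \<mapsto> n))"
        using F ltn by (intro fish.op_ii) (auto simp: D'_def)
      then show ?thesis unfolding yD[OF d(1), symmetric] nU[OF d(2)] .
    next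
      case ud
      then obtain a where a: "U a = Some b" "D a = Some c" using square by blast
      have "b \<noteq> n" "c \<noteq> n" using ud last by auto
      then have "fish (Suc n) (U'(c \<mapsto> n)) (D'(b \<mapsto> n))"
        using F ltn a ud by (intro fish.op_iii[of n U' D' a b c]) (auto simp: U'_def D'_def)
      then show ?thesis unfolding yU[OF ud(2), symmetric] yD[OF ud(1), symmetric] .
    qed
  qed
qed

section \<open>Encoding of fish by trees\<close>

text \<open>A tree lists the row of cells that starts at a cell and continues through right lower edges;
  \<open>Tip\<close> is the free right lower edge at its end. A cell is \<open>Bare\<close> if its right upper edge is free.
  Otherwise a cell is glued to this edge: if the left upper edge of that cell is free, it is the first
  cell of the row of the first subtree of \<open>Start\<close>, and if not, the cell is \<open>Cont\<close> and lies below the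
  continuation of a row that was entered by an earlier \<open>Start\<close>.\<close>

datatype ftree = Tip | Bare ftree | Cont ftree | Start ftree ftree

primrec row_len :: "ftree \<Rightarrow> nat" where
  "row_len Tip = 0"
| "row_len (Bare t) = Suc (row_len t)"
| "row_len (Cont t) = Suc (row_len t)"
| "row_len (Start s t) = Suc (row_len t)"

primrec nbare :: "ftree \<Rightarrow> nat" where
  "nbare Tip = 0"
| "nbare (Bare t) = Suc (nbare t)"
| "nbare (Cont t) = nbare t"
| "nbare (Start s t) = nbare s + nbare t"

primrec ntip :: "ftree \<Rightarrow> nat" where
  "ntip Tip = 1"
| "ntip (Bare t) = ntip t"
| "ntip (Cont t) = ntip t"
| "ntip (Start s t) = ntip s + ntip t"

text \<open>The number \<open>m\<close> counts the cells that are left in the row entered by the last \<open>Start\<close>; it bounds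
  the number of \<open>Cont\<close> cells that may follow.\<close>

primrec valid :: "nat \<Rightarrow> ftree \<Rightarrow> bool" where
  "valid m Tip \<longleftrightarrow> True"
| "valid m (Bare t) \<longleftrightarrow> valid 0 t"
| "valid m (Cont t) \<longleftrightarrow> m > 0 \<and> valid (m - 1) t"
| "valid m (Start s t) \<longleftrightarrow> s \<noteq> Tip \<and> valid 0 s \<and> valid (row_len s - 1) t"

text \<open>A \<open>Cont\<close> node does not store the cell above it, since that cell already
  occurs in the row containing the cell on its left upper edge. Hence no cell is listed
  twice.\<close>

inductive encodes :: "('a \<Rightarrow> 'a option) \<Rightarrow> ('a \<Rightarrow> 'a option) \<Rightarrow> 'a option \<Rightarrow> ftree \<Rightarrow> bool"
  for U D :: "'a \<Rightarrow> 'a option" where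
  Tip: "encodes U D None Tip"
| Bare: "U x = None \<Longrightarrow> encodes U D (D x) t \<Longrightarrow> encodes U D (Some x) (Bare t)"
| Cont: "U x = Some b \<Longrightarrow> D y = Some b \<Longrightarrow> encodes U D (D x) t \<Longrightarrow> encodes U D (Some x) (Cont t)"
| Start: "U x = Some b \<Longrightarrow> (\<And>y. D y \<noteq> Some b) \<Longrightarrow> encodes U D (Some b) s \<Longrightarrow>
    encodes U D (D x) t \<Longrightarrow> encodes U D (Some x) (Start s t)"

inductive_cases encodes_NoneE: "encodes U D None t"
inductive_cases encodes_SomeE: "encodes U D (Some x) t"

lemma encodes_Tip_iff: "encodes U D z Tip \<longleftrightarrow> z = None"
  by (subst encodes.simps) auto

lemma encodes_Bare_iff:
  "encodes U D (Some x) (Bare t) \<longleftrightarrow> U x = None \<and> encodes U D (D x) t"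
  by (subst encodes.simps) auto

lemma encodes_Cont_iff:
  "encodes U D (Some x) (Cont t) \<longleftrightarrow> (\<exists>b y. U x = Some b \<and> D y = Some b) \<and> encodes U D (D x) t"
  by (subst encodes.simps) auto

lemma encodes_Start_iff:
  "encodes U D (Some x) (Start s t) \<longleftrightarrow>
     (\<exists>b. U x = Some b \<and> (\<forall>y. D y \<noteq> Some b) \<and> encodes U D (Some b) s) \<and> encodes U D (D x) t"
  by (subst encodes.simps) auto

lemma encodes_unique: "encodes U D z t \<Longrightarrow> encodes U D z t' \<Longrightarrow> t = t'"
proof (induction arbitrary: t' rule: encodes.induct)
  case Tip
  then show ?case by (auto elim: encodes_NoneE)
next
  case (Bare x t)
  from Bare.prems show ?case by (rule encodes_SomeE) (use Bare.IH Bare.hyps in auto)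
next
  case (Cont x b y t)
  from Cont.prems show ?case by (rule encodes_SomeE) (use Cont.IH Cont.hyps in auto)
next
  case outer: (Start x b s t)
  from outer.prems show ?case
  proof (cases rule: encodes.cases)
    case (Start b' s' r')
    then show ?thesis using outer.IH outer.hyps(1) by simp
  qed (use outer.hyps(1,2) in auto)
qed

lemma encodes_row:
  assumes "encodes U D (Some x) t"
  obtains t' where "encodes U D (D x) t'" "row_len t = Suc (row_len t')"
  using assms by (cases rule: encodes.cases) auto

context glued_cells
begin

lemma rank_le: "x \<in> C \<Longrightarrow> rank x \<le> Max (rank ` C)"
  using finite_cells by simp

lemma encodes_exists: "x \<in> C \<Longrightarrow> \<exists>t. encodes U D (Some x) t"
proof (induction "Max (rank ` C) - rank x" arbitrary: x rule: less_induct)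
  case less
  have step: "\<exists>t. encodes U D (Some y) t" if "U x = Some y \<or> D x = Some y" for y
    using less.hyps[of y] U_cells[of x y] D_cells[of x y] that rank_le[of y] by fastforce
  have D: "\<exists>t. encodes U D (D x) t"
    using step by (cases "D x") (auto intro: encodes.Tip)
  show ?case
  proof (cases "U x")
    case None
    then show ?thesis using D encodes.Bare by metis
  next
    case (Some b)
    then show ?thesis using D step[of b] encodes.Cont[of U x b D] encodes.Start[of U x b D] by metis
  qed
qed

text \<open>The premise ties \<open>m\<close> to geometry: if \<open>a\<close> precedes
  \<open>x\<close> in the row and \<open>y\<close> lies above \<open>a\<close>, then
  \<open>m\<close> cells follow \<open>y\<close> in its row. For a \<open>Cont\<close> cell,
  \<open>square\<close> and injectivity force the cell above \<open>x\<close> to be the one after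
  \<open>y\<close>, so \<open>m\<close> is positive and drops by one. After a bare cell the premise
  is vacuous.\<close>

lemma encodes_valid:
  assumes "encodes U D z t"
    and "\<And>x a y. z = Some x \<Longrightarrow> D a = Some x \<Longrightarrow> U a = Some y \<Longrightarrow>
           \<exists>s. encodes U D (D y) s \<and> row_len s = m"
  shows "valid m t"
  using assms
proof (induction arbitrary: m rule: encodes.induct)
  case Tip
  then show ?case by simp
next
  case (Bare x t)
  have "valid 0 t" by (rule Bare.IH) (use Bare.hyps D_inj in fastforce)
  then show ?case by simp
next
  case (Cont x b y t)
  from square[OF Cont.hyps(1,2)] obtain a where "U a = Some y" "D a = Some x" by blast
  then obtain s where s: "encodes U D (D y) s" "row_len s = m" using Cont.prems by blast
  then obtain s' where s': "encodes U D (D b) s'" "row_len s = Suc (row_len s')"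
    using encodes_row Cont.hyps(2) by metis
  have "valid (m - 1) t"
    by (rule Cont.IH) (use s s' Cont.hyps D_inj in fastforce)
  then show ?case using s s' by simp
next
  case (Start x b s t)
  have "s \<noteq> Tip" using Start.hyps(3) encodes_Tip_iff by auto
  moreover have "valid 0 s" by (rule Start.IH) (use Start.hyps in auto)
  moreover obtain s' where s': "encodes U D (D b) s'" "row_len s = Suc (row_len s')"
    using encodes_row[OF Start.hyps(3)] .
  have "valid (row_len s - 1) t" by (rule Start.IH) (use s' Start.hyps D_inj in fastforce)
  ultimately show ?case by simp
qed

lemma encodes_head_valid: "encodes U D (Some h) t \<Longrightarrow> valid 0 t"
  by (rule encodes_valid) (auto simp: head_not_D)

end

section \<open>Fish with equal codes are isomorphic\<close>

text \<open>Pairs of cells reached in two fish along the same path, where every non-head cell is reached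
  through its left upper edge if that edge is glued and through its left lower edge otherwise.\<close>

inductive paired ::
  "('a \<Rightarrow> 'a option) \<Rightarrow> ('a \<Rightarrow> 'a option) \<Rightarrow> 'a \<Rightarrow> ('b \<Rightarrow> 'b option) \<Rightarrow> ('b \<Rightarrow> 'b option) \<Rightarrow> 'b \<Rightarrow>
    'a \<Rightarrow> 'b \<Rightarrow> bool"
  for U D h U' D' h' where
  head: "paired U D h U' D' h' h h'"
| down: "paired U D h U' D' h' x x' \<Longrightarrow> D x = Some y \<Longrightarrow> D' x' = Some y' \<Longrightarrow>
    paired U D h U' D' h' y y'"
| up: "paired U D h U' D' h' x x' \<Longrightarrow> U x = Some y \<Longrightarrow> U' x' = Some y' \<Longrightarrow>
    (\<And>v. D v \<noteq> Some y) \<Longrightarrow> (\<And>v. D' v \<noteq> Some y') \<Longrightarrow> paired U D h U' D' h' y y'"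

lemma paired_sym: "paired U D h U' D' h' x x' \<Longrightarrow> paired U' D' h' U D h x' x"
  by (induction rule: paired.induct) (auto intro: paired.intros)

locale two_glued = F: glued_cells C U D rank h + G: glued_cells C' U' D' rank' h'
  for C :: "'a set" and U D rank h and C' :: "'b set" and U' D' rank' h' +
  fixes t
  assumes enc: "encodes U D (Some h) t" and enc': "encodes U' D' (Some h') t"
begin

abbreviation "pr \<equiv> paired U D h U' D' h'"

lemma paired_cells: "pr x x' \<Longrightarrow> x \<in> C \<and> x' \<in> C'"
  by (induction rule: paired.induct)
     (auto simp: F.head_cell G.head_cell dest: F.U_cells F.D_cells G.U_cells G.D_cells)

lemma paired_encodes:
  "pr x x' \<Longrightarrow> \<exists>s. encodes U D (Some x) s \<and> encodes U' D' (Some x') s"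
proof (induction rule: paired.induct)
  case head
  then show ?case using enc enc' by blast
next
  case (down x x' y y')
  then obtain s where "encodes U D (Some x) s" "encodes U' D' (Some x') s" by blast
  then show ?case using down.hyps
    by (cases s) (auto simp: encodes_Tip_iff encodes_Bare_iff encodes_Cont_iff encodes_Start_iff)
next
  case (up x x' y y')
  then obtain s where "encodes U D (Some x) s" "encodes U' D' (Some x') s" by blast
  then show ?case using up.hyps
    by (cases s) (auto simp: encodes_Tip_iff encodes_Bare_iff encodes_Cont_iff encodes_Start_iff)
qed

lemma paired_D:
  assumes "pr x x'" "D x = Some y"
  shows "\<exists>y'. D' x' = Some y' \<and> pr y y'"
proof -
  obtain s where "encodes U D (Some x) s" "encodes U' D' (Some x') s"
    using paired_encodes[OF assms(1)] by blast
  then have "\<exists>s'. encodes U D (D x) s' \<and> encodes U' D' (D' x') s'"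
    by (cases s) (auto simp: encodes_Tip_iff encodes_Bare_iff encodes_Cont_iff encodes_Start_iff)
  then have "D' x' \<noteq> None" using assms(2) by (metis encodes_NoneE encodes_Tip_iff option.distinct(1))
  then show ?thesis using assms paired.down by (metis not_None_eq)
qed

text \<open>The freeness conditions in \<open>up\<close> make \<open>up\<close> and
  \<open>down\<close> exclusive, and injectivity of the gluings fixes the predecessor. Each cell
  thus has a single access path, which determines its partner.\<close>

lemma paired_fun: "pr x x' \<Longrightarrow> pr x x'' \<Longrightarrow> x' = x''"
proof (induction arbitrary: x'' rule: paired.induct)
  case head
  from head show ?case
    by (cases rule: paired.cases) (use F.head_not_U F.head_not_D in auto)
next
  case outer: (down x x' y y')
  from outer.prems show ?case
  proof (cases rule: paired.cases)
    case (down u u')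
    then have "u = x" using F.D_inj outer.hyps(2) by blast
    then have "x' = u'" using outer.IH down(1) by simp
    then show ?thesis using outer.hyps(3) down(3) by simp
  qed (use F.head_not_D outer.hyps in auto)
next
  case outer: (up x x' y y')
  from outer.prems show ?case
  proof (cases rule: paired.cases)
    case (up u u')
    then have "u = x" using F.U_inj outer.hyps(2) by blast
    then have "x' = u'" using outer.IH up(1) by simp
    then show ?thesis using outer.hyps(3) up(3) by simp
  qed (use F.head_not_U outer.hyps in auto)
qed

lemma paired_Start:
  assumes "pr x x'" "U x = Some b" "encodes U D (Some x) (Start q r)" "encodes U' D' (Some x') (Start q r)"
  shows "\<exists>b'. U' x' = Some b' \<and> pr b b'"
proof -
  obtain b' where "U' x' = Some b'" "\<forall>y. D' y \<noteq> Some b'" using assms(4) encodes_Start_iff by metis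
  moreover have "\<forall>y. D y \<noteq> Some b" using assms(2,3) encodes_Start_iff by (metis option.inject)
  ultimately show ?thesis using assms(1,2) paired.up by metis
qed

text \<open>The critical edges are those that access paths avoid, at \<open>Cont\<close> cells.
  There the upper cell \<open>b\<close> is also the row successor of the cell \<open>v\<close> above
  the previous cell; the partner of \<open>v\<close> comes from the induction hypothesis, and
  \<open>square\<close> in the second fish shows that its row successor is the cell above
  \<open>y'\<close>.\<close>

lemma paired_U: "pr x x' \<Longrightarrow> U x = Some b \<Longrightarrow> \<exists>b'. U' x' = Some b' \<and> pr b b'"
proof (induction arbitrary: b rule: paired.induct)
  case head
  have "\<not> (\<exists>y. D y = Some b)" using F.square[OF head] F.head_not_D by blast
  then obtain s r where "t = Start s r" using enc head
    by (cases t) (auto simp: encodes_Tip_iff encodes_Bare_iff encodes_Cont_iff encodes_Start_iff)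
  then show ?case using enc enc' head paired.head paired_Start by metis
next
  case (down x x' y y')
  have pr: "pr y y'" by (rule paired.down[OF down.hyps])
  obtain s where s: "encodes U D (Some y) s" "encodes U' D' (Some y') s"
    using paired_encodes[OF pr] by blast
  show ?case
  proof (cases "\<exists>v. D v = Some b")
    case True
    then obtain v where v: "D v = Some b" by blast
    from F.square[OF down.prems v] obtain a where "U a = Some v" "D a = Some y" by blast
    then have "U x = Some v" using F.D_inj down.hyps by blast
    then obtain v' where v': "U' x' = Some v'" "pr v v'" using down.IH by blast
    obtain r where "s = Cont r" using s(1) True down.prems
      by (cases s) (auto simp: encodes_Tip_iff encodes_Bare_iff encodes_Cont_iff encodes_Start_iff)
    then obtain b' w where b': "U' y' = Some b'" "D' w = Some b'"
      using s(2) by (auto simp: encodes_Cont_iff)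
    from G.square[OF this] obtain a' where "U' a' = Some w" "D' a' = Some y'" by blast
    then have "w = v'" using G.D_inj down.hyps v' by (metis option.inject)
    then show ?thesis using b' paired.down[OF v'(2) v] by blast
  next
    case False
    then obtain q r where "s = Start q r" using s(1) down.prems
      by (cases s) (auto simp: encodes_Tip_iff encodes_Bare_iff encodes_Cont_iff encodes_Start_iff)
    then show ?thesis using s down.prems pr paired_Start by metis
  qed
next
  case (up x x' y y')
  have pr: "pr y y'" by (rule paired.up) (use up.hyps in auto)
  obtain s where s: "encodes U D (Some y) s" "encodes U' D' (Some y') s"
    using paired_encodes[OF pr] by blast
  have "\<not> (\<exists>v. D v = Some b)" using F.square[OF up.prems] up.hyps by blast
  then obtain q r where "s = Start q r" using s(1) up.prems
    by (cases s) (auto simp: encodes_Tip_iff encodes_Bare_iff encodes_Cont_iff encodes_Start_iff)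
  then show ?case using s up.prems pr paired_Start by metis
qed

lemma paired_total: "x \<in> C \<Longrightarrow> \<exists>x'. pr x x'"
proof (induction "rank x" arbitrary: x rule: less_induct)
  case less
  show ?case
  proof (cases "x = h")
    case True
    then show ?thesis using paired.head by fast
  next
    case False
    then obtain y where "U y = Some x \<or> D y = Some x" using F.has_pred less.prems by blast
    moreover from this obtain y' where "pr y y'"
      using less.hyps[of y] F.U_cells[of y x] F.D_cells[of y x] by blast
    ultimately show ?thesis using paired_U[of y y' x] paired_D[of y y' x] by blast
  qed
qed

end

lemma two_glued_sym:
  "two_glued C U D rank h C' U' D' rank' h' t \<Longrightarrow> two_glued C' U' D' rank' h' C U D rank h t"
  unfolding two_glued_def two_glued_axioms_def by blast

lemma same_encoding_imp_iso:
  assumes "glued_cells C U D rank h" "glued_cells C' U' D' rank' h'"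
    and "encodes U D (Some h) t" "encodes U' D' (Some h') t"
  shows "\<exists>f. bij_betw f C C' \<and>
           (\<forall>x\<in>C. U' (f x) = map_option f (U x) \<and> D' (f x) = map_option f (D x))"
proof -
  interpret A: two_glued C U D rank h C' U' D' rank' h' t
    using assms by (simp add: two_glued_def two_glued_axioms_def)
  interpret B: two_glued C' U' D' rank' h' C U D rank h t
    by (rule two_glued_sym) (rule A.two_glued_axioms)
  define f where "f x = (SOME x'. A.pr x x')" for x
  have f: "A.pr x (f x)" if "x \<in> C" for x
    unfolding f_def using A.paired_total[OF that] by (rule someI_ex)
  have f_eq: "f x = x'" if "A.pr x x'" for x x'
    using A.paired_fun[OF that] f A.paired_cells[OF that] by metis
  have "inj_on f C"
  proof (rule inj_onI)
    fix x y assume "x \<in> C" "y \<in> C" "f x = f y"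
    then show "x = y" using B.paired_fun[OF paired_sym[OF f[of x]], of y] paired_sym[OF f[of y]] by simp
  qed
  moreover have "f ` C = C'"
  proof
    show "f ` C \<subseteq> C'" using f A.paired_cells by blast
    show "C' \<subseteq> f ` C"
    proof
      fix x' assume "x' \<in> C'"
      then obtain x where "B.pr x' x" using B.paired_total by blast
      then have "A.pr x x'" by (rule paired_sym)
      then show "x' \<in> f ` C" using f_eq A.paired_cells by blast
    qed
  qed
  moreover have "U' (f x) = map_option f (U x)" if "x \<in> C" for x
  proof (cases "U x")
    case None
    then have "U' (f x) = None"
      using B.paired_U[OF paired_sym[OF f[OF that]]] by (metis not_None_eq)
    then show ?thesis using None by simp
  next
    case (Some b)
    then show ?thesis using A.paired_U[OF f[OF that]] f_eq by auto
  qed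
  moreover have "D' (f x) = map_option f (D x)" if "x \<in> C" for x
  proof (cases "D x")
    case None
    then have "D' (f x) = None"
      using B.paired_D[OF paired_sym[OF f[OF that]]] by (metis not_None_eq)
    then show ?thesis using None by simp
  next
    case (Some b)
    then show ?thesis using A.paired_D[OF f[OF that]] f_eq by auto
  qed
  ultimately show ?thesis unfolding bij_betw_def by blast
qed

section \<open>Realisation of a valid tree as a fish\<close>

text \<open>Names for the cells of the fish encoded by a tree: the path from the root, most recent step
  first, where \<open>True\<close> goes to the first subtree of a \<open>Start\<close> node.\<close>

primrec subtree :: "ftree \<Rightarrow> bool list \<Rightarrow> ftree" where
  "subtree t [] = t"
| "subtree t (d # p) = (case subtree t p of Tip \<Rightarrow> Tip
     | Bare s \<Rightarrow> if d then Tip else s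
     | Cont s \<Rightarrow> if d then Tip else s
     | Start s' s \<Rightarrow> if d then s' else s)"

text \<open>A \<open>Cont\<close> cell is placed below the row successor of the cell above its own
  predecessor, which is just what \<open>square\<close> demands. At the start of a row the value is
  a dummy: validity rules out \<open>Cont\<close> there.\<close>

primrec tree_U :: "ftree \<Rightarrow> bool list \<Rightarrow> bool list option" where
  "tree_U t [] = (case t of Start s' s \<Rightarrow> Some [True] | _ \<Rightarrow> None)"
| "tree_U t (d # p) = (case subtree t (d # p) of Start s' s \<Rightarrow> Some (True # d # p)
     | Cont s \<Rightarrow> if d then None else map_option (Cons False) (tree_U t p) | _ \<Rightarrow> None)"

definition tree_D :: "ftree \<Rightarrow> bool list \<Rightarrow> bool list option" where
  "tree_D t p = (if subtree t (False # p) = Tip then None else Some (False # p))"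

definition tree_cells :: "ftree \<Rightarrow> bool list set" where
  "tree_cells t = {p. subtree t p \<noteq> Tip}"

text \<open>The last list element is the first step from the root, so splitting there follows the
  recursion on the tree, whereas the definition follows the path.\<close>

lemma subtree_snoc:
  "subtree t (p @ [d]) = (case t of Tip \<Rightarrow> Tip
     | Bare s \<Rightarrow> if d then Tip else subtree s p
     | Cont s \<Rightarrow> if d then Tip else subtree s p
     | Start s' s \<Rightarrow> if d then subtree s' p else subtree s p)"
  by (induction p) (auto split: ftree.splits)

lemma subtree_Tip [simp]: "subtree Tip p = Tip"
  by (induction p) auto

lemma tree_U_Start: "subtree t p = Start s' s \<Longrightarrow> tree_U t p = Some (True # p)"
  by (cases p) auto

lemma subtree_set_decomp:
  "{p. Q (subtree t p)} = (if Q t then {[]} else {}) \<union>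
     (\<lambda>p. p @ [True]) ` {p. Q (subtree t (p @ [True]))} \<union>
     (\<lambda>p. p @ [False]) ` {p. Q (subtree t (p @ [False]))}" (is "?L = ?R")
proof
  show "?L \<subseteq> ?R"
  proof
    fix p assume "p \<in> ?L"
    then show "p \<in> ?R"
    proof (cases p rule: rev_cases)
      case (snoc q d)
      then show ?thesis using \<open>p \<in> ?L\<close> by (cases d) auto
    qed auto
  qed
  show "?R \<subseteq> ?L" by (auto split: if_splits)
qed

lemma finite_tree_cells: "finite (tree_cells t)"
proof (induction t)
  case (Bare t)
  then show ?case unfolding tree_cells_def by (subst subtree_set_decomp) (auto simp: subtree_snoc)
next
  case (Cont t)
  then show ?case unfolding tree_cells_def by (subst subtree_set_decomp) (auto simp: subtree_snoc)
next
  case (Start t1 t2)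
  then show ?case unfolding tree_cells_def by (subst subtree_set_decomp) (auto simp: subtree_snoc)
qed (auto simp: tree_cells_def)

text \<open>Infinitely many paths lead to \<open>Tip\<close>, so \<open>Q\<close> has to fail there
  for the count to be meaningful.\<close>

lemma card_subtree:
  assumes "\<not> Q Tip"
  shows "card {p. Q (subtree t p)} = (if Q t then 1 else 0) + (case t of Tip \<Rightarrow> 0
     | Bare s \<Rightarrow> card {p. Q (subtree s p)}
     | Cont s \<Rightarrow> card {p. Q (subtree s p)}
     | Start s' s \<Rightarrow> card {p. Q (subtree s' p)} + card {p. Q (subtree s p)})"
proof -
  have fin: "finite {p. Q (subtree s p)}" for s
    using assms by (intro finite_subset[OF _ finite_tree_cells[of s]]) (auto simp: tree_cells_def)
  have fin': "finite {p. Q (subtree t (p @ [d]))}" for d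
    using assms fin by (cases t; cases d) (auto simp: subtree_snoc)
  have inj: "inj_on (\<lambda>p. p @ [d]) A" for d :: bool and A by (auto simp: inj_on_def)
  have "card {p. Q (subtree t p)} = (if Q t then 1 else 0) +
     (card {p. Q (subtree t (p @ [True]))} + card {p. Q (subtree t (p @ [False]))})"
    using fin' by (subst subtree_set_decomp) (subst card_Un_disjoint; auto simp: card_image[OF inj] card_insert_if)+
  then show ?thesis using assms by (cases t) (auto simp: subtree_snoc)
qed

lemma card_Bare_cells: "card {p. \<exists>s. subtree t p = Bare s} = nbare t"
  by (induction t) (subst card_subtree[where Q = "\<lambda>t. \<exists>s. t = Bare s"]; auto)+

text \<open>Every nonempty row has exactly one last cell, which matches its \<open>Tip\<close>.
  Validity keeps the first subtree of a \<open>Start\<close> from being an empty row, whose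
  \<open>Tip\<close> would belong to no cell.\<close>

lemma card_Tip_cells:
  "valid m t \<Longrightarrow> card {p. subtree t p \<noteq> Tip \<and> subtree t (False # p) = Tip} = (if t = Tip then 0 else ntip t)"
proof -
  define Q where "Q t \<longleftrightarrow> t = Bare Tip \<or> t = Cont Tip \<or> (\<exists>s. t = Start s Tip)" for t
  have Q: "subtree t p \<noteq> Tip \<and> subtree t (False # p) = Tip \<longleftrightarrow> Q (subtree t p)" for t p
    by (cases "subtree t p") (auto simp: Q_def)
  have "valid m t \<Longrightarrow> card {p. Q (subtree t p)} = (if t = Tip then 0 else ntip t)"
  proof (induction t arbitrary: m)
    case Tip
    then show ?case by (simp add: Q_def)
  next
    case (Bare t)
    then show ?case by (subst card_subtree) (auto simp: Q_def)
  next
    case (Cont t)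
    then have "valid (m - 1) t" by simp
    from Cont.IH[OF this] show ?case by (subst card_subtree) (auto simp: Q_def)
  next
    case (Start s t)
    then have "valid 0 s" "valid (row_len s - 1) t" "s \<noteq> Tip" by auto
    from Start.IH(1)[OF this(1)] Start.IH(2)[OF this(2)] this(3) show ?case
      by (subst card_subtree) (auto simp: Q_def)
  qed
  then show "valid m t \<Longrightarrow> ?thesis" unfolding Q .
qed

lemma row_len_down: "row_len (subtree t (False # p)) = row_len (subtree t p) - 1"
  by (cases "subtree t p") auto

text \<open>The invariant behind the construction: the number of \<open>Cont\<close> cells permitted
  after \<open>p\<close> is the number of cells left in the row above \<open>p\<close>, so the upper
  cell required by a \<open>Cont\<close> node always exists.\<close>

lemma tree_U_cases:
  assumes "valid 0 t"
  shows "(\<exists>m. valid m (subtree t p)) \<and>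
    (subtree t p = Tip \<or> (\<exists>s. subtree t p = Bare s) \<or>
     (\<exists>y. tree_U t p = Some y \<and> subtree t y \<noteq> Tip \<and>
          valid (row_len (subtree t y) - 1) (subtree t (False # p))))" (is "?R p")
proof -
  have fresh: "?R p" if "valid 0 (subtree t p)" for p
  proof (cases "subtree t p")
    case (Start s' s)
    then show ?thesis using that tree_U_Start[OF Start] by (auto intro: exI[of _ 0])
  qed (use that in \<open>auto intro: exI[of _ 0]\<close>)
  show ?thesis
  proof (induction p)
    case Nil
    show ?case by (rule fresh) (use assms in simp)
  next
    case (Cons d p)
    then obtain m where m: "valid m (subtree t p)" by blast
    show ?case
    proof (cases "d \<or> subtree t p = Tip \<or> (\<exists>s. subtree t p = Bare s)")
      case True
      then have "valid 0 (subtree t (d # p))" using m by (auto split: ftree.splits)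
      then show ?thesis by (rule fresh)
    next
      case False
      then obtain y where y: "tree_U t p = Some y" "subtree t y \<noteq> Tip"
        "valid (row_len (subtree t y) - 1) (subtree t (False # p))"
        using Cons.IH by blast
      have d: "d = False" using False by simp
      show ?thesis
      proof (cases "subtree t (False # p)")
        case (Cont s)
        then have U: "tree_U t (False # p) = Some (False # y)" using y by simp
        have "row_len (subtree t y) - 1 > 0" "valid (row_len (subtree t y) - 1 - 1) s"
          using y(3) unfolding Cont by auto
        moreover from this have "subtree t (False # y) \<noteq> Tip"
          using row_len_down[of t y] by (metis not_less0 row_len.simps(1))
        moreover have "subtree t (False # False # p) = s" using Cont by simp
        ultimately show ?thesis unfolding d using U y(3) row_len_down[of t y] by metis
      next
        case (Start s' s)
        then have "tree_U t (False # p) = Some (True # False # p)" by (rule tree_U_Start)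
        moreover have "subtree t (True # False # p) = s'" "subtree t (False # False # p) = s"
          using Start by simp_all
        moreover have "s' \<noteq> Tip" "valid (row_len s' - 1) s" using y(3) unfolding Start by auto
        ultimately show ?thesis unfolding d using y(3) by metis
      qed (use y d in \<open>auto split: ftree.splits\<close>)
    qed
  qed
qed

lemma tree_U_False: "tree_U t p = Some (False # y) \<Longrightarrow> \<exists>q. p = False # q \<and> tree_U t q = Some y"
  by (cases p) (auto split: ftree.splits if_splits)

lemma tree_U_length: "tree_U t p = Some y \<Longrightarrow> length y = Suc (length p)"
  by (induction p arbitrary: y) (auto split: ftree.splits if_splits)

lemma tree_U_cell: "tree_U t p = Some y \<Longrightarrow> subtree t p \<noteq> Tip"
  by (cases p) (auto split: ftree.splits)


lemma tree_U_inj: "tree_U t p = Some y \<Longrightarrow> tree_U t q = Some y \<Longrightarrow> p = q"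
proof (induction y arbitrary: p q)
  case Nil
  then show ?case using tree_U_length by fastforce
next
  case (Cons d y)
  show ?case
  proof (cases d)
    case True
    then have "y = p" if "tree_U t p = Some (d # y)" for p
      using that by (cases p) (auto split: ftree.splits if_splits)
    then show ?thesis using Cons.prems by metis
  next
    case False
    then show ?thesis using Cons tree_U_False by (metis (full_types))
  qed
qed

lemma glued_cells_tree:
  assumes "valid 0 t" "t \<noteq> Tip"
  shows "glued_cells (tree_cells t) (tree_U t) (tree_D t) length []"
proof
  show "finite (tree_cells t)" by (rule finite_tree_cells)
  show "[] \<in> tree_cells t" using assms by (simp add: tree_cells_def)
next
  fix x y assume xy: "tree_U t x = Some y"
  have "subtree t x \<noteq> Tip" by (rule tree_U_cell[OF xy])
  moreover have "\<not> (\<exists>s. subtree t x = Bare s)" using xy by (cases x) auto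
  ultimately have "subtree t y \<noteq> Tip" using tree_U_cases[OF assms(1), of x] xy by auto
  then show "x \<in> tree_cells t \<and> y \<in> tree_cells t \<and> length x < length y"
    using tree_U_length[OF xy] \<open>subtree t x \<noteq> Tip\<close> by (simp add: tree_cells_def)
next
  fix x y assume "tree_D t x = Some y"
  then show "x \<in> tree_cells t \<and> y \<in> tree_cells t \<and> length x < length y"
    by (auto simp: tree_D_def tree_cells_def split: if_splits ftree.splits)
next
  fix x y x' assume "tree_U t x = Some y" "tree_U t x' = Some y"
  then show "x = x'" by (rule tree_U_inj)
next
  fix x y x' assume "tree_D t x = Some y" "tree_D t x' = Some y"
  then show "x = x'" by (auto simp: tree_D_def split: if_splits)
next
  fix c d b assume c: "tree_U t c = Some d" and b: "tree_D t b = Some d"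
  have "d = False # b" using b by (auto simp: tree_D_def split: if_splits)
  then obtain q where q: "c = False # q" "tree_U t q = Some b" using tree_U_False c by blast
  moreover have "tree_D t q = Some c" using tree_U_cell[OF c] q by (simp add: tree_D_def)
  ultimately show "\<exists>a. tree_U t a = Some b \<and> tree_D t a = Some c" by blast
next
  fix x show "tree_U t x \<noteq> Some []" using tree_U_length[of t x "[]"] by auto
  show "tree_D t x \<noteq> Some []" by (simp add: tree_D_def)
next
  fix y assume y: "y \<in> tree_cells t" "y \<noteq> []"
  then obtain d p where [simp]: "y = d # p" by (cases y) auto
  show "\<exists>x. tree_U t x = Some y \<or> tree_D t x = Some y"
  proof (cases d)
    case True
    then obtain s' s where "subtree t p = Start s' s"
      using y by (auto simp: tree_cells_def split: ftree.splits)
    from tree_U_Start[OF this] show ?thesis using True by auto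
  next
    case False
    then show ?thesis using y by (auto simp: tree_cells_def tree_D_def intro!: exI[of _ p])
  qed
qed

lemma encodes_tree:
  assumes "valid 0 t"
  shows "encodes (tree_U t) (tree_D t) (if subtree t p = Tip then None else Some p) (subtree t p)"
proof -
  have tree_D_eq: "tree_D t p = (if s = Tip then None else Some (False # p))"
    if "subtree t (False # p) = s" for p s
    using that by (simp only: tree_D_def)
  have "subtree t p = s \<Longrightarrow> encodes (tree_U t) (tree_D t) (if s = Tip then None else Some p) s" for s
  proof (induction s arbitrary: p)
    case Tip
    then show ?case by (auto intro: encodes.Tip)
  next
    case (Bare s)
    have "tree_U t p = None" using Bare.prems by (cases p) auto
    moreover have "encodes (tree_U t) (tree_D t) (tree_D t p) s"
      using Bare.IH[of "False # p"] Bare.prems tree_D_eq[of p s] by simp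
    ultimately show ?case by (auto intro: encodes.Bare)
  next
    case (Cont s)
    have D: "encodes (tree_U t) (tree_D t) (tree_D t p) s"
      using Cont.IH[of "False # p"] Cont.prems tree_D_eq[of p s] by simp
    obtain y where y: "tree_U t p = Some y" "subtree t y \<noteq> Tip"
      using tree_U_cases[OF assms, of p] Cont.prems by auto
    then obtain z where z: "y = False # z" using Cont.prems
      by (cases p) (auto split: ftree.splits if_splits)
    have "tree_D t z = Some y" using y z by (auto simp: tree_D_def)
    from encodes.Cont[OF y(1) this D] show ?case by simp
  next
    case (Start s' s)
    have D: "encodes (tree_U t) (tree_D t) (tree_D t p) s"
      using Start.IH(2)[of "False # p"] Start.prems tree_D_eq[of p s] by simp
    obtain m where "valid m (Start s' s)" using tree_U_cases[OF assms, of p] Start.prems by auto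
    then have "s' \<noteq> Tip" by simp
    then have "encodes (tree_U t) (tree_D t) (Some (True # p)) s'"
      using Start.IH(1)[of "True # p"] Start.prems by simp
    moreover have "tree_D t y \<noteq> Some (True # p)" for y by (simp add: tree_D_def)
    ultimately have "encodes (tree_U t) (tree_D t) (Some p) (Start s' s)"
      by (intro encodes.Start[OF tree_U_Start[OF Start.prems] _ _ D])
    then show ?case by simp
  qed
  then show ?thesis by blast
qed

lemma encodes_tree_root:
  "valid 0 t \<Longrightarrow> t \<noteq> Tip \<Longrightarrow> encodes (tree_U t) (tree_D t) (Some []) t"
  using encodes_tree[of t "[]"] by simp

text \<open>Free edges are counted in the path model, where the node at a path shows whether an edge
  is free; the isomorphism obtained from the common code carries the counts back.\<close>

lemma (in glued_cells) stat_encodes: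
  assumes "encodes U D (Some h) t"
  shows "card {x \<in> C. U x = None} = nbare t" "card {x \<in> C. D x = None} = ntip t"
proof -
  have v: "valid 0 t" by (rule encodes_head_valid[OF assms])
  have ne: "t \<noteq> Tip" using assms encodes_Tip_iff by fastforce
  from same_encoding_imp_iso[OF glued_cells_axioms glued_cells_tree[OF v ne] assms encodes_tree_root[OF v ne]]
  obtain f where f: "bij_betw f C (tree_cells t)"
    and fU: "\<And>x. x \<in> C \<Longrightarrow> tree_U t (f x) = map_option f (U x)"
    and fD: "\<And>x. x \<in> C \<Longrightarrow> tree_D t (f x) = map_option f (D x)" by blast
  have "card {x \<in> C. U x = None} = card (f ` {x \<in> C. U x = None})"
    using f by (intro card_image[symmetric]) (auto simp: bij_betw_def inj_on_def)
  also have "f ` {x \<in> C. U x = None} = {p \<in> f ` C. tree_U t p = None}"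
    using fU by auto
  also have "f ` C = tree_cells t" using f by (simp add: bij_betw_def)
  also have "{p \<in> tree_cells t. tree_U t p = None} = {p. \<exists>s. subtree t p = Bare s}"
  proof -
    have "p \<in> tree_cells t \<and> tree_U t p = None \<longleftrightarrow> (\<exists>s. subtree t p = Bare s)" for p
    proof
      assume "p \<in> tree_cells t \<and> tree_U t p = None"
      then show "\<exists>s. subtree t p = Bare s" using tree_U_cases[OF v, of p] by (auto simp: tree_cells_def)
    next
      assume "\<exists>s. subtree t p = Bare s"
      then show "p \<in> tree_cells t \<and> tree_U t p = None" by (cases p) (auto simp: tree_cells_def)
    qed
    then show ?thesis by blast
  qed
  finally show "card {x \<in> C. U x = None} = nbare t" by (simp add: card_Bare_cells)
  have "card {x \<in> C. D x = None} = card (f ` {x \<in> C. D x = None})"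
    using f by (intro card_image[symmetric]) (auto simp: bij_betw_def inj_on_def)
  also have "f ` {x \<in> C. D x = None} = {p \<in> f ` C. tree_D t p = None}"
    using fD by auto
  also have "f ` C = tree_cells t" using f by (simp add: bij_betw_def)
  also have "{p \<in> tree_cells t. tree_D t p = None} = {p. subtree t p \<noteq> Tip \<and> subtree t (False # p) = Tip}"
    by (auto simp: tree_cells_def tree_D_def simp del: subtree.simps)
  finally show "card {x \<in> C. D x = None} = ntip t" using card_Tip_cells[OF v] ne by simp
qed

section \<open>Transport of structure and relabelling\<close>

lemma (in glued_cells) encodes_iso:
  assumes "inj_on f C"
    and "\<And>x. x \<in> C \<Longrightarrow> U' (f x) = map_option f (U x)"
    and "\<And>x. x \<in> C \<Longrightarrow> D' (f x) = map_option f (D x)"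
    and "\<And>x. x \<notin> f ` C \<Longrightarrow> D' x = None"
    and "encodes U D z t" and "\<And>x. z = Some x \<Longrightarrow> x \<in> C"
  shows "encodes U' D' (map_option f z) t"
  using assms(5,6)
proof (induction rule: encodes.induct)
  case Tip
  then show ?case by (auto intro: encodes.Tip)
next
  case (Bare x t)
  then have x: "x \<in> C" by simp
  then have "encodes U' D' (D' (f x)) t" using Bare.IH assms(3) D_cells by auto
  then show ?case using assms(2)[OF x] Bare.hyps by (auto intro: encodes.Bare)
next
  case (Cont x b y t)
  then have x: "x \<in> C" by simp
  have y: "y \<in> C" using Cont.hyps D_cells by blast
  have "encodes U' D' (D' (f x)) t" using Cont.IH assms(3)[OF x] D_cells by auto
  then show ?case using encodes.Cont[of U' "f x" "f b" D' "f y"] assms(2)[OF x] assms(3)[OF y] Cont.hyps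
    by auto
next
  case (Start x b s t)
  then have x: "x \<in> C" by simp
  have b: "b \<in> C" using Start.hyps U_cells by blast
  have "encodes U' D' (D' (f x)) t" using Start.IH(2) assms(3)[OF x] D_cells by auto
  moreover have "encodes U' D' (Some (f b)) s" using Start.IH(1) b by auto
  moreover have "D' y \<noteq> Some (f b)" for y
  proof
    assume y: "D' y = Some (f b)"
    then obtain v where v: "v \<in> C" "y = f v" using assms(4)[of y] by auto
    then obtain b' where b': "D v = Some b'" "f b' = f b" using y assms(3) by auto
    then have "b' = b" using inj_onD[OF assms(1), of b' b] b D_cells[of v b'] by auto
    then show False using b' Start.hyps by blast
  qed
  ultimately show ?case using encodes.Start[of U' "f x" "f b" D'] assms(2)[OF x] Start.hyps(1) by auto
qed

lemma (in glued_cells) glued_cells_iso: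
  assumes "bij_betw f C C'"
    and fU: "\<And>x. x \<in> C \<Longrightarrow> U' (f x) = map_option f (U x)"
    and fD: "\<And>x. x \<in> C \<Longrightarrow> D' (f x) = map_option f (D x)"
    and outside: "\<And>x. x \<notin> C' \<Longrightarrow> U' x = None" "\<And>x. x \<notin> C' \<Longrightarrow> D' x = None"
    and mono: "\<And>x y. x \<in> C \<Longrightarrow> y \<in> C \<Longrightarrow> rank x < rank y \<Longrightarrow> rank' (f x) < rank' (f y)"
  shows "glued_cells C' U' D' rank' (f h)"
proof -
  have C': "C' = f ` C" and inj: "inj_on f C" using assms(1) by (auto simp: bij_betw_def)
  have eq: "f x = f y \<Longrightarrow> x \<in> C \<Longrightarrow> y \<in> C \<Longrightarrow> x = y" for x y using inj by (auto simp: inj_on_def)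
  have U': "U' x' = Some y' \<longleftrightarrow> (\<exists>x\<in>C. \<exists>y\<in>C. x' = f x \<and> y' = f y \<and> U x = Some y)" for x' y'
  proof
    assume *: "U' x' = Some y'"
    then obtain x where "x \<in> C" "x' = f x" using outside(1) C' by fastforce
    then show "\<exists>x\<in>C. \<exists>y\<in>C. x' = f x \<and> y' = f y \<and> U x = Some y"
      using * fU[of x] U_cells by auto
  qed (use fU in auto)
  have D': "D' x' = Some y' \<longleftrightarrow> (\<exists>x\<in>C. \<exists>y\<in>C. x' = f x \<and> y' = f y \<and> D x = Some y)" for x' y'
  proof
    assume *: "D' x' = Some y'"
    then obtain x where "x \<in> C" "x' = f x" using outside(2) C' by fastforce
    then show "\<exists>x\<in>C. \<exists>y\<in>C. x' = f x \<and> y' = f y \<and> D x = Some y"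
      using * fD[of x] D_cells by auto
  qed (use fD in auto)
  show ?thesis
  proof
    show "finite C'" using C' finite_cells by simp
    show "f h \<in> C'" using C' head_cell by simp
  next
    fix x y assume "U' x = Some y"
    then obtain x0 y0 where "x0 \<in> C" "y0 \<in> C" "x = f x0" "y = f y0" "U x0 = Some y0"
      unfolding U' by blast
    then show "x \<in> C' \<and> y \<in> C' \<and> rank' x < rank' y" using U_cells[of x0 y0] mono C' by simp
  next
    fix x y assume "D' x = Some y"
    then obtain x0 y0 where "x0 \<in> C" "y0 \<in> C" "x = f x0" "y = f y0" "D x0 = Some y0"
      unfolding D' by blast
    then show "x \<in> C' \<and> y \<in> C' \<and> rank' x < rank' y" using D_cells[of x0 y0] mono C' by simp
  next
    fix x y x' assume "U' x = Some y" "U' x' = Some y"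
    then obtain x0 y0 x1 y1 where *: "y0 \<in> C" "x = f x0" "y = f y0" "U x0 = Some y0"
      "y1 \<in> C" "x' = f x1" "y = f y1" "U x1 = Some y1"
      unfolding U' by blast
    then have "y1 = y0" using eq[of y1 y0] by simp
    then show "x = x'" using * U_inj[of x0 y0 x1] by simp
  next
    fix x y x' assume "D' x = Some y" "D' x' = Some y"
    then obtain x0 y0 x1 y1 where *: "y0 \<in> C" "x = f x0" "y = f y0" "D x0 = Some y0"
      "y1 \<in> C" "x' = f x1" "y = f y1" "D x1 = Some y1"
      unfolding D' by blast
    then have "y1 = y0" using eq[of y1 y0] by simp
    then show "x = x'" using * D_inj[of x0 y0 x1] by simp
  next
    fix c d b assume "U' c = Some d" "D' b = Some d"
    then obtain c0 d0 b0 d1 where *: "c0 \<in> C" "d0 \<in> C" "b0 \<in> C" "d1 \<in> C" "c = f c0" "d = f d0"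
      "b = f b0" "d = f d1" "U c0 = Some d0" "D b0 = Some d1" unfolding U' D' by blast
    then have "d1 = d0" using eq[of d1 d0] by simp
    then obtain a where "U a = Some b0" "D a = Some c0" using * square[of c0 d0 b0] by blast
    moreover from this have "a \<in> C" using U_cells by blast
    ultimately show "\<exists>a. U' a = Some b \<and> D' a = Some c" unfolding U' D' using * by blast
  next
    fix x show "U' x \<noteq> Some (f h)"
      unfolding U' using eq[of h] head_cell head_not_U by auto
    show "D' x \<noteq> Some (f h)"
      unfolding D' using eq[of h] head_cell head_not_D by auto
  next
    fix y assume "y \<in> C'" "y \<noteq> f h"
    then obtain y0 where y0: "y0 \<in> C" "y = f y0" "y0 \<noteq> h" using C' by blast
    then obtain x where "U x = Some y0 \<or> D x = Some y0" using has_pred by blast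
    moreover from this have "x \<in> C" using U_cells D_cells by blast
    ultimately show "\<exists>x. U' x = Some y \<or> D' x = Some y" unfolding U' D' using y0 by blast
  qed
qed

text \<open>A topological sort: it turns any rank into consecutive labels, as required for an order
  of construction.\<close>

lemma exists_rank_labelling:
  fixes rank :: "'a \<Rightarrow> nat"
  assumes "finite C"
  shows "\<exists>f. bij_betw f C {0..<card C} \<and> (\<forall>x\<in>C. \<forall>y\<in>C. rank x < rank y \<longrightarrow> f x < f y)"
  using assms
proof (induction rule: finite_ranking_induct[where f = rank])
  case empty
  then show ?case by (auto simp: bij_betw_def)
next
  case (insert x S)
  show ?case
  proof (cases "x \<in> S")
    case True
    then show ?thesis using insert.IH by (simp add: insert_absorb)
  next
    case False
    obtain f where f: "bij_betw f S {0..<card S}" "\<forall>x\<in>S. \<forall>y\<in>S. rank x < rank y \<longrightarrow> f x < f y"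
      using insert.IH by blast
    define g where "g = f(x := card S)"
    have g: "g x = card S" "\<And>y. y \<in> S \<Longrightarrow> g y = f y" using False by (auto simp: g_def)
    have "bij_betw g S {0..<card S}" using f(1) g(2) by (simp cong: bij_betw_cong)
    then have "bij_betw g (S \<union> {x}) ({0..<card S} \<union> {card S})"
      using False g by (intro bij_betw_combine) auto
    moreover have "{0..<card S} \<union> {card S} = {0..<card (insert x S)}"
      using False insert.hyps by auto
    ultimately have "bij_betw g (insert x S) {0..<card (insert x S)}" by simp
    moreover have "g y < g z" if "y \<in> insert x S" "z \<in> insert x S" "rank y < rank z" for y z
    proof -
      have "y \<in> S" using that insert.hyps(2)[of z] by (cases "y = x") auto
      moreover have "f y < card S" using f(1) \<open>y \<in> S\<close> by (auto simp: bij_betw_def)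
      ultimately show ?thesis using that g f(2) by (cases "z = x") auto
    qed
    ultimately show ?thesis by blast
  qed
qed

lemma fish_of_tree:
  assumes "valid 0 t" "t \<noteq> Tip"
  obtains n U D where "fish n U D" "encodes U D (Some 0) t"
proof -
  interpret T: glued_cells "tree_cells t" "tree_U t" "tree_D t" length "[]"
    by (rule glued_cells_tree[OF assms])
  define n where "n = card (tree_cells t)"
  obtain f where f: "bij_betw f (tree_cells t) {0..<n}"
    "\<forall>x\<in>tree_cells t. \<forall>y\<in>tree_cells t. length x < length y \<longrightarrow> f x < f y"
    using exists_rank_labelling[OF finite_tree_cells[of t], of length] n_def by blast
  define g where "g = inv_into (tree_cells t) f"
  have g: "g (f x) = x" if "x \<in> tree_cells t" for x
    using that f(1) by (simp add: g_def bij_betw_def)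
  have fl: "f x < n" if "x \<in> tree_cells t" for x using that f(1) by (auto simp: bij_betw_def)
  define U where "U k = (if k < n then map_option f (tree_U t (g k)) else None)" for k
  define D where "D k = (if k < n then map_option f (tree_D t (g k)) else None)" for k
  have "glued_cells {0..<n} U D (\<lambda>x. x) (f [])"
    by (rule T.glued_cells_iso[OF f(1)]) (use f(2) g fl in \<open>auto simp: U_def D_def\<close>)
  then interpret G: glued_cells "{0..<n}" U D "\<lambda>x. x" "f []" .
  \<comment> \<open>Any other cell has a predecessor with a smaller label, which label 0 cannot
    have.\<close>
  have f0: "f [] = 0"
  proof (rule ccontr)
    assume "f [] \<noteq> 0"
    moreover have "0 \<in> {0..<n}" using G.head_cell by simp
    ultimately obtain x where "U x = Some 0 \<or> D x = Some 0" using G.has_pred by metis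
    then show False using G.U_cells G.D_cells by blast
  qed
  have "encodes U D (map_option f (Some [])) t"
    by (rule T.encodes_iso[OF _ _ _ _ encodes_tree_root[OF assms]])
       (use f(1) g fl T.head_cell in \<open>auto simp: U_def D_def bij_betw_def\<close>)
  moreover have "fish n U D" using glued_cells_imp_fish G.glued_cells_axioms f0 by metis
  ultimately show thesis using that f0 by auto
qed

section \<open>Isomorphism classes as trees\<close>

definition fish_trees :: "nat \<Rightarrow> nat \<Rightarrow> ftree set" where
  "fish_trees i j = {t. t \<noteq> Tip \<and> valid 0 t \<and> nbare t = i \<and> ntip t = j}"

definition fish_code :: "fish_rep \<Rightarrow> ftree" where
  "fish_code F = (case F of (n, U, D) \<Rightarrow> THE t. encodes U D (Some 0) t)"

lemma fish_code_eq: "encodes U D (Some 0) t \<Longrightarrow> fish_code (n, U, D) = t"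
  unfolding fish_code_def prod.case by (rule the_equality) (auto intro: encodes_unique)

lemma encodes_fish_code:
  assumes "fish n U D"
  shows "encodes U D (Some 0) (fish_code (n, U, D))"
proof -
  interpret glued_cells "{0..<n}" U D "\<lambda>x. x" 0 by (rule fish_imp_glued_cells[OF assms])
  obtain t where "encodes U D (Some 0) t" using encodes_exists[OF head_cell] by blast
  then show ?thesis using fish_code_eq by metis
qed

lemma free_right_lower_fish:
  assumes "fish n U D"
  shows "free_right_lower (n, U, D) = ntip (fish_code (n, U, D))"
proof -
  interpret glued_cells "{0..<n}" U D "\<lambda>x. x" 0 by (rule fish_imp_glued_cells[OF assms])
  show ?thesis using stat_encodes(2)[OF encodes_fish_code[OF assms]]
    by (simp add: free_right_lower_def)
qed

text \<open>\<open>U\<close> is a partial injection of the finite cell set, so equally many cells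
  lie outside its domain and outside its range. This trades free left lower edges for free right
  upper ones.\<close>

lemma free_left_lower_fish:
  assumes "fish n U D"
  shows "free_left_lower (n, U, D) = nbare (fish_code (n, U, D))"
proof -
  interpret glued_cells "{0..<n}" U D "\<lambda>x. x" 0 by (rule fish_imp_glued_cells[OF assms])
  define A where "A = {x. x < n \<and> (\<forall>y<n. U y \<noteq> Some x)}"
  define B where "B = {x. x < n \<and> U x = None}"
  have "bij_betw (\<lambda>y. the (U y)) ({0..<n} - B) ({0..<n} - A)"
  proof (rule bij_betw_imageI)
    show "inj_on (\<lambda>y. the (U y)) ({0..<n} - B)"
      by (rule inj_onI) (use U_inj in \<open>auto simp: B_def\<close>)
    show "(\<lambda>y. the (U y)) ` ({0..<n} - B) = {0..<n} - A"
    proof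
      show "(\<lambda>y. the (U y)) ` ({0..<n} - B) \<subseteq> {0..<n} - A"
        using U_cells by (fastforce simp: A_def B_def)
      show "{0..<n} - A \<subseteq> (\<lambda>y. the (U y)) ` ({0..<n} - B)"
      proof
        fix x assume "x \<in> {0..<n} - A"
        then obtain y where "y < n" "U y = Some x" by (auto simp: A_def)
        then show "x \<in> (\<lambda>y. the (U y)) ` ({0..<n} - B)"
          by (intro image_eqI[of _ _ y]) (auto simp: B_def)
      qed
    qed
  qed
  then have "card ({0..<n} - B) = card ({0..<n} - A)" by (rule bij_betw_same_card)
  moreover have "A \<subseteq> {0..<n}" "B \<subseteq> {0..<n}" by (auto simp: A_def B_def)
  ultimately have "card A = card B"
    by (metis card_Diff_subset card_mono diff_diff_cancel finite_atLeastLessThan finite_subset)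
  moreover have "card B = nbare (fish_code (n, U, D))"
    using stat_encodes(1)[OF encodes_fish_code[OF assms]] by (simp add: B_def)
  ultimately show ?thesis by (simp add: free_left_lower_def A_def)
qed

lemma fish_iso_refl: "fish_iso F F"
  unfolding fish_iso_def by (cases F) (auto intro!: exI[of _ id] simp: option.map_id)

lemma fish_iso_trans: "fish_iso F G \<Longrightarrow> fish_iso G H \<Longrightarrow> fish_iso F H"
proof -
  assume "fish_iso F G" "fish_iso G H"
  obtain n U D where F: "F = (n, U, D)" by (cases F)
  obtain m U' D' where G: "G = (m, U', D')" by (cases G)
  obtain k U'' D'' where H: "H = (k, U'', D'')" by (cases H)
  obtain f where f: "bij_betw f {0..<n} {0..<m}"
    "\<forall>x<n. U' (f x) = map_option f (U x) \<and> D' (f x) = map_option f (D x)"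
    using \<open>fish_iso F G\<close> by (auto simp: fish_iso_def F G)
  obtain g where g: "bij_betw g {0..<m} {0..<k}"
    "\<forall>x<m. U'' (g x) = map_option g (U' x) \<and> D'' (g x) = map_option g (D' x)"
    using \<open>fish_iso G H\<close> by (auto simp: fish_iso_def G H)
  have "f x < m" if "x < n" for x using f(1) that by (auto simp: bij_betw_def)
  then show ?thesis unfolding F H fish_iso_def prod.case
    using bij_betw_trans[OF f(1) g(1)] f(2) g(2)
    by (intro exI[of _ "g \<circ> f"]) (auto simp: option.map_comp)
qed

lemma fish_iso_iff_code:
  assumes F: "fish n U D" and G: "fish m U' D'"
  shows "fish_iso (n, U, D) (m, U', D') \<longleftrightarrow> fish_code (n, U, D) = fish_code (m, U', D')"
proof
  interpret F: glued_cells "{0..<n}" U D "\<lambda>x. x" 0 by (rule fish_imp_glued_cells[OF F])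
  interpret G: glued_cells "{0..<m}" U' D' "\<lambda>x. x" 0 by (rule fish_imp_glued_cells[OF G])
  {
    assume "fish_code (n, U, D) = fish_code (m, U', D')"
    then have "encodes U D (Some 0) (fish_code (m, U', D'))"
      using encodes_fish_code[OF F] by simp
    from same_encoding_imp_iso[OF F.glued_cells_axioms G.glued_cells_axioms this encodes_fish_code[OF G]]
    show "fish_iso (n, U, D) (m, U', D')"
      by (simp add: fish_iso_def Ball_def)
  }
  assume "fish_iso (n, U, D) (m, U', D')"
  then obtain f where f: "bij_betw f {0..<n} {0..<m}"
    "\<And>x. x < n \<Longrightarrow> U' (f x) = map_option f (U x)" "\<And>x. x < n \<Longrightarrow> D' (f x) = map_option f (D x)"
    by (auto simp: fish_iso_def)
  have img: "f ` {0..<n} = {0..<m}" and inj: "inj_on f {0..<n}" using f(1) by (auto simp: bij_betw_def)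
  have "f 0 = 0"
  proof (rule ccontr)
    assume "f 0 \<noteq> 0"
    moreover have "f 0 \<in> {0..<m}" using img F.head_cell by blast
    ultimately obtain y where y: "U' y = Some (f 0) \<or> D' y = Some (f 0)" using G.has_pred by blast
    then have "y \<in> {0..<m}" using G.U_cells G.D_cells by blast
    then obtain x where x: "x \<in> {0..<n}" "y = f x" using img by blast
    then obtain z where z: "f z = f 0" "U x = Some z \<or> D x = Some z" using y f(2,3)[of x] by auto
    then have "z \<in> {0..<n}" using F.U_cells F.D_cells by blast
    then have "z = 0" using z(1) inj F.head_cell by (auto dest: inj_onD)
    then show False using z(2) F.head_not_U F.head_not_D by blast
  qed
  have "encodes U' D' (map_option f (Some 0)) (fish_code (n, U, D))"
  proof (rule F.encodes_iso[OF inj _ _ _ encodes_fish_code[OF F]])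
    fix x assume "x \<notin> f ` {0..<n}"
    then show "D' x = None" using G.D_cells[of x] img by (cases "D' x") auto
  qed (use f F.head_cell in auto)
  then show "fish_code (n, U, D) = fish_code (m, U', D')"
    using fish_code_eq \<open>f 0 = 0\<close> by simp
qed

lemma card_image_same_kernel:
  assumes "\<And>x y. x \<in> A \<Longrightarrow> y \<in> A \<Longrightarrow> f x = f y \<longleftrightarrow> g x = g y"
  shows "card (f ` A) = card (g ` A)"
proof (rule bij_betw_same_card)
  show "bij_betw (\<lambda>v. g (inv_into A f v)) (f ` A) (g ` A)"
  proof (rule bij_betw_imageI)
    show "inj_on (\<lambda>v. g (inv_into A f v)) (f ` A)"
      by (rule inj_onI) (metis assms f_inv_into_f inv_into_into)
    have "g (inv_into A f (f x)) = g x" if "x \<in> A" for x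
      using assms that by (metis f_inv_into_f imageI inv_into_into)
    then show "(\<lambda>v. g (inv_into A f v)) ` (f ` A) = g ` A" by (auto simp: image_image)
  qed
qed

lemma num_fish_eq_card_fish_trees: "num_fish i j = card (fish_trees i j)"
proof -
  let ?A = "fish_reps i j"
  have "?A // fish_iso_rel = (\<lambda>F. fish_iso_rel `` {F}) ` ?A" by (auto simp: quotient_def)
  moreover have "card ((\<lambda>F. fish_iso_rel `` {F}) ` ?A) = card (fish_code ` ?A)"
  proof (rule card_image_same_kernel)
    fix F G assume FG: "F \<in> ?A" "G \<in> ?A"
    have iff: "fish_iso F G \<longleftrightarrow> fish_code F = fish_code G" if "F \<in> ?A" "G \<in> ?A" for F G
      using that fish_iso_iff_code by (auto simp: fish_reps_def)
    have "fish_iso_rel `` {F} = fish_iso_rel `` {G} \<longleftrightarrow> fish_iso F G"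
    proof
      assume "fish_iso_rel `` {F} = fish_iso_rel `` {G}"
      then show "fish_iso F G" using fish_iso_refl[of G] by (auto simp: fish_iso_rel_def)
    next
      assume "fish_iso F G"
      moreover from this have "fish_iso G F" using iff FG by metis
      ultimately show "fish_iso_rel `` {F} = fish_iso_rel `` {G}"
        using fish_iso_trans[of F G] fish_iso_trans[of G F]
        by (intro equalityI subsetI) (simp_all add: fish_iso_rel_def)
    qed
    then show "fish_iso_rel `` {F} = fish_iso_rel `` {G} \<longleftrightarrow> fish_code F = fish_code G"
      using iff FG by simp
  qed
  moreover have "fish_code ` ?A = fish_trees i j"
  proof
    show "fish_code ` ?A \<subseteq> fish_trees i j"
    proof
      fix t assume "t \<in> fish_code ` ?A"
      then obtain n U D where F: "fish n U D" "free_left_lower (n, U, D) = i"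
        "free_right_lower (n, U, D) = j" "t = fish_code (n, U, D)"
        by (auto simp: fish_reps_def)
      interpret glued_cells "{0..<n}" U D "\<lambda>x. x" 0 by (rule fish_imp_glued_cells[OF F(1)])
      have e: "encodes U D (Some 0) t" using encodes_fish_code F by simp
      then have "t \<noteq> Tip" using encodes_Tip_iff by fastforce
      then show "t \<in> fish_trees i j"
        using F encodes_head_valid[OF e] free_left_lower_fish free_right_lower_fish
        by (auto simp: fish_trees_def)
    qed
    show "fish_trees i j \<subseteq> fish_code ` ?A"
    proof
      fix t assume t: "t \<in> fish_trees i j"
      then have "valid 0 t" "t \<noteq> Tip" by (auto simp: fish_trees_def)
      then obtain n U D where F: "fish n U D" "encodes U D (Some 0) t" by (rule fish_of_tree)
      then have c: "fish_code (n, U, D) = t" using fish_code_eq by blast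
      then have "(n, U, D) \<in> ?A"
        using t F(1) free_left_lower_fish[OF F(1)] free_right_lower_fish[OF F(1)]
        by (auto simp: fish_reps_def fish_trees_def)
      then show "t \<in> fish_code ` ?A" using c by blast
    qed
  qed
  ultimately show ?thesis by (simp add: num_fish_def)
qed

section \<open>The functional equation\<close>

text \<open>The size \<open>n\<close> will be the order in \<open>fps_X\<close> guaranteed for the
  weight of a tree when \<open>x\<close> and \<open>y\<close> are multiples of \<open>fps_X\<close>.
  \<open>Cont\<close> nodes add nothing to it; only validity bounds their number.\<close>

definition trees :: "nat \<Rightarrow> nat \<Rightarrow> ftree set" where
  "trees n m = {t. valid m t \<and> nbare t + ntip t = n}"

lemma ntip_pos: "0 < ntip t"
  by (induction t) auto

lemma trees_zero [simp]: "trees 0 m = {}"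
  using ntip_pos by (auto simp: trees_def)

lemma trees_no_Cont:
  "trees n 0 = (if n = 1 then {Tip} else {}) \<union> Bare ` trees (n - 1) 0 \<union>
     (\<Union>p\<in>{1..<n}. \<Union>s\<in>trees p 0 - {Tip}. Start s ` trees (n - p) (row_len s - 1))" (is "?L = ?R")
proof
  show "?L \<subseteq> ?R"
  proof
    fix t assume t: "t \<in> ?L"
    show "t \<in> ?R"
    proof (cases t)
      case (Start s r)
      then show ?thesis using t ntip_pos[of s] ntip_pos[of r]
        by (auto simp: trees_def intro!: bexI[of _ "nbare s + ntip s"] bexI[of _ s])
    qed (use t in \<open>auto simp: trees_def\<close>)
  qed
  have "Bare ` trees (n - 1) 0 \<subseteq> trees n 0"
  proof (cases n)
    case (Suc k)
    then show ?thesis by (auto simp: trees_def)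
  qed simp
  then show "?R \<subseteq> ?L" by (auto simp: trees_def split: if_splits)
qed

lemma trees_Suc: "trees n (Suc m) = trees n 0 \<union> Cont ` trees n m"
proof -
  have "t \<in> trees n (Suc m) \<longleftrightarrow> t \<in> trees n 0 \<union> Cont ` trees n m" for t
    by (cases t) (auto simp: trees_def)
  then show ?thesis by blast
qed

lemma finite_trees: "finite (trees n m)"
proof (induction n arbitrary: m rule: less_induct)
  case (less n)
  have "finite (trees (n - 1) 0)" by (cases "n = 0") (auto simp: less)
  then have "finite (trees n 0)" by (subst trees_no_Cont) (auto simp: less)
  then show ?case by (induction m) (auto simp: trees_Suc)
qed

definition tree_sum :: "'a \<Rightarrow> 'a \<Rightarrow> 'a \<Rightarrow> nat \<Rightarrow> nat \<Rightarrow> 'a::comm_ring_1" where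
  "tree_sum x y u n m = (\<Sum>t\<in>trees n m. x ^ nbare t * y ^ ntip t * u ^ row_len t)"

lemma tree_sum_zero [simp]: "tree_sum x y u 0 m = 0"
  by (simp add: tree_sum_def)

lemma tree_sum_Suc: "tree_sum x y u n (Suc m) = tree_sum x y u n 0 + u * tree_sum x y u n m"
proof -
  let ?w = "\<lambda>t. x ^ nbare t * y ^ ntip t * u ^ row_len t"
  have "Cont t \<notin> trees n 0" for t by (simp add: trees_def)
  then have "trees n 0 \<inter> Cont ` trees n m = {}" by blast
  then have "sum ?w (trees n (Suc m)) = sum ?w (trees n 0) + sum ?w (Cont ` trees n m)"
    unfolding trees_Suc by (intro sum.union_disjoint finite_imageI finite_trees)
  also have "sum ?w (Cont ` trees n m) = (\<Sum>t\<in>trees n m. ?w (Cont t))"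
    by (rule sum.reindex_cong[where l = Cont]) (auto simp: inj_on_def)
  also have "\<dots> = u * sum ?w (trees n m)"
    unfolding sum_distrib_left by (rule sum.cong) (simp_all add: mult_ac)
  finally show ?thesis by (simp only: tree_sum_def)
qed

text \<open>A tree in \<open>trees n m\<close> is a tree of \<open>trees n 0\<close> below at most
  \<open>m\<close> nodes \<open>Cont\<close>, which gives a geometric sum in \<open>u\<close>.
  Multiplying by \<open>u - 1\<close> avoids a division.\<close>

lemma tree_sum_geometric:
  "(u - 1) * tree_sum x y u n m = tree_sum x y u n 0 * (u ^ Suc m - 1)"
proof (induction m)
  case (Suc m)
  have "(u - 1) * tree_sum x y u n (Suc m) =
    (u - 1) * tree_sum x y u n 0 + u * ((u - 1) * tree_sum x y u n m)"
    by (simp add: tree_sum_Suc algebra_simps)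
  then show ?case unfolding Suc.IH by (simp add: algebra_simps)
qed (simp add: mult.commute)

lemma tree_sum_decomp:
  "tree_sum x y u n 0 = (if n = 1 then y else 0) + x * u * tree_sum x y u (n - 1) 0 +
     (\<Sum>p\<in>{1..<n}. \<Sum>s\<in>trees p 0 - {Tip}.
        u * (x ^ nbare s * y ^ ntip s) * tree_sum x y u (n - p) (row_len s - 1))"
proof -
  let ?w = "\<lambda>t. x ^ nbare t * y ^ ntip t * u ^ row_len t"
  let ?T = "if n = 1 then {Tip} else {}"
  let ?S = "\<lambda>p s. Start s ` trees (n - p) (row_len s - 1)"
  let ?Q = "\<Union>p\<in>{1..<n}. \<Union>s\<in>trees p 0 - {Tip}. ?S p s"
  have "tree_sum x y u n 0 = sum ?w ?T + sum ?w (Bare ` trees (n - 1) 0) + sum ?w ?Q"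
    unfolding tree_sum_def
    by (subst trees_no_Cont, subst sum.union_disjoint, (auto simp: finite_trees)[3],
        subst sum.union_disjoint) (auto simp: finite_trees)
  moreover have "sum ?w ?T = (if n = 1 then y else 0)" by simp
  moreover have "sum ?w (Bare ` trees (n - 1) 0) = x * u * tree_sum x y u (n - 1) 0"
    unfolding tree_sum_def sum_distrib_left
    by (rule sum.reindex_cong[where l = Bare]) (auto simp: inj_on_def mult_ac)
  moreover have "sum ?w ?Q = (\<Sum>p\<in>{1..<n}. \<Sum>s\<in>trees p 0 - {Tip}. sum ?w (?S p s))"
  proof -
    have "sum ?w ?Q = (\<Sum>p\<in>{1..<n}. sum ?w (\<Union>s\<in>trees p 0 - {Tip}. ?S p s))"
    proof (rule sum.UNION_disjoint)
      have "p = nbare s + ntip s" if "s \<in> trees p 0" for p s using that by (simp add: trees_def)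
      then show "\<forall>p\<in>{1..<n}. \<forall>q\<in>{1..<n}. p \<noteq> q \<longrightarrow>
          (\<Union>s\<in>trees p 0 - {Tip}. ?S p s) \<inter> (\<Union>s\<in>trees q 0 - {Tip}. ?S q s) = {}"
        by blast
    qed (auto simp: finite_trees)
    also have "\<dots> = (\<Sum>p\<in>{1..<n}. \<Sum>s\<in>trees p 0 - {Tip}. sum ?w (?S p s))"
      by (intro sum.cong refl sum.UNION_disjoint) (auto simp: finite_trees)
    finally show ?thesis .
  qed
  moreover have "sum ?w (?S p s) = u * (x ^ nbare s * y ^ ntip s) * tree_sum x y u (n - p) (row_len s - 1)"
    for p s
    unfolding tree_sum_def sum_distrib_left
    by (rule sum.reindex_cong[where l = "Start s"]) (auto simp: inj_on_def mult_ac power_add)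
  ultimately show ?thesis by simp
qed

text \<open>Summing the geometric factor \<open>u ^ row_len s - 1\<close> over the first subtrees
  \<open>s\<close> of \<open>Start\<close> yields the difference of the tree sums at
  \<open>u\<close> and at 1. This is where the second unknown enters.\<close>

lemma tree_sum_equation:
  "(u - 1) * tree_sum x y u n 0 = (u - 1) * (if n = 1 then y else 0) +
     (u - 1) * x * u * tree_sum x y u (n - 1) 0 +
     u * (\<Sum>p\<le>n. (tree_sum x y u p 0 - tree_sum x y 1 p 0) * tree_sum x y u (n - p) 0)"
proof -
  have row: "row_len t = 0 \<longleftrightarrow> t = Tip" for t by (cases t) auto
  have inner: "(u - 1) * (\<Sum>s\<in>trees p 0 - {Tip}.
        u * (x ^ nbare s * y ^ ntip s) * tree_sum x y u k (row_len s - 1)) =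
      u * ((tree_sum x y u p 0 - tree_sum x y 1 p 0) * tree_sum x y u k 0)" for p k
  proof -
    have "(u - 1) * (\<Sum>s\<in>trees p 0 - {Tip}.
        u * (x ^ nbare s * y ^ ntip s) * tree_sum x y u k (row_len s - 1)) =
      (\<Sum>s\<in>trees p 0 - {Tip}. u * (x ^ nbare s * y ^ ntip s) *
        ((u - 1) * tree_sum x y u k (row_len s - 1)))"
      by (simp add: sum_distrib_left mult_ac)
    also have "\<dots> = (\<Sum>s\<in>trees p 0 - {Tip}. u * (x ^ nbare s * y ^ ntip s) *
        (tree_sum x y u k 0 * (u ^ row_len s - 1)))"
    proof (intro sum.cong refl)
      fix s assume "s \<in> trees p 0 - {Tip}"
      then have "Suc (row_len s - 1) = row_len s" using row[of s] by simp
      then show "u * (x ^ nbare s * y ^ ntip s) * ((u - 1) * tree_sum x y u k (row_len s - 1)) =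
        u * (x ^ nbare s * y ^ ntip s) * (tree_sum x y u k 0 * (u ^ row_len s - 1))"
        by (simp only: tree_sum_geometric)
    qed
    \<comment> \<open>\<open>Tip\<close> may be readmitted now, because its factor
      \<open>u ^ 0 - 1\<close> vanishes.\<close>
    also have "\<dots> = (\<Sum>s\<in>trees p 0. u * (x ^ nbare s * y ^ ntip s) *
        (tree_sum x y u k 0 * (u ^ row_len s - 1)))"
      by (rule sum.mono_neutral_left) (auto simp: finite_trees)
    also have "\<dots> = u * (\<Sum>s\<in>trees p 0. x ^ nbare s * y ^ ntip s * u ^ row_len s -
        x ^ nbare s * y ^ ntip s) * tree_sum x y u k 0"
      by (simp add: sum_distrib_left sum_distrib_right algebra_simps)
    finally show ?thesis by (simp add: tree_sum_def sum_subtractf mult.assoc)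
  qed
  have "(\<Sum>p\<in>{1..<n}. (tree_sum x y u p 0 - tree_sum x y 1 p 0) * tree_sum x y u (n - p) 0) =
    (\<Sum>p\<le>n. (tree_sum x y u p 0 - tree_sum x y 1 p 0) * tree_sum x y u (n - p) 0)"
  proof (rule sum.mono_neutral_left)
    show "\<forall>p\<in>{..n} - {1..<n}. (tree_sum x y u p 0 - tree_sum x y 1 p 0) * tree_sum x y u (n - p) 0 = 0"
    proof
      fix p assume "p \<in> {..n} - {1..<n}"
      then have "p = 0 \<or> p = n" by auto
      then show "(tree_sum x y u p 0 - tree_sum x y 1 p 0) * tree_sum x y u (n - p) 0 = 0" by auto
    qed
  qed auto
  moreover have "(u - 1) * (\<Sum>p\<in>{1..<n}. \<Sum>s\<in>trees p 0 - {Tip}.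
        u * (x ^ nbare s * y ^ ntip s) * tree_sum x y u (n - p) (row_len s - 1)) =
     u * (\<Sum>p\<in>{1..<n}. (tree_sum x y u p 0 - tree_sum x y 1 p 0) * tree_sum x y u (n - p) 0)"
    by (subst sum_distrib_left, subst inner) (simp add: sum_distrib_left)
  ultimately show ?thesis
    by (subst tree_sum_decomp) (simp add: distrib_left mult.assoc)
qed

section \<open>Infinite sums of formal power series\<close>

lemma fps_mult_nth_eq_0:
  fixes f g :: "'a::comm_ring_1 fps"
  assumes "\<And>k. k < p \<Longrightarrow> f $ k = 0" "\<And>k. k < q \<Longrightarrow> g $ k = 0" "m < p + q"
  shows "(f * g) $ m = 0"
  unfolding fps_mult_nth
proof (rule sum.neutral, safe)
  fix k assume "k \<in> {0..m}"
  then have "k < p \<or> m - k < q" using assms(3) by auto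
  then show "f $ k * g $ (m - k) = 0" using assms(1,2) by auto
qed

text \<open>Says that \<open>fps_X ^ n\<close> divides \<open>\<phi> n\<close>. Each coefficient of
  the infinite sum of all \<open>\<phi> n\<close> is then a finite sum, so no notion of convergence
  is needed.\<close>

definition graded :: "(nat \<Rightarrow> 'a::comm_ring_1 fps) \<Rightarrow> bool" where
  "graded \<phi> \<longleftrightarrow> (\<forall>n m. m < n \<longrightarrow> \<phi> n $ m = 0)"

definition graded_sum :: "(nat \<Rightarrow> 'a::comm_ring_1 fps) \<Rightarrow> 'a fps" where
  "graded_sum \<phi> = Abs_fps (\<lambda>N. \<Sum>n\<le>N. \<phi> n $ N)"

lemma graded_sum_nth: "graded \<phi> \<Longrightarrow> N \<le> M \<Longrightarrow> graded_sum \<phi> $ N = (\<Sum>n\<le>M. \<phi> n $ N)"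
  unfolding graded_sum_def fps_nth_Abs_fps
  by (rule sum.mono_neutral_left) (auto simp: graded_def)

lemma graded_sum_mult:
  fixes \<phi> \<chi> :: "nat \<Rightarrow> 'a::comm_ring_1 fps"
  assumes "graded \<phi>" "graded \<chi>"
  shows "graded_sum \<phi> * graded_sum \<chi> = graded_sum (\<lambda>n. \<Sum>p\<le>n. \<phi> p * \<chi> (n - p))"
proof (rule fps_ext)
  fix N
  have "(graded_sum \<phi> * graded_sum \<chi>) $ N =
    (\<Sum>k\<in>{0..N}. (\<Sum>p\<le>N. \<phi> p $ k) * (\<Sum>q\<le>N. \<chi> q $ (N - k)))"
    unfolding fps_mult_nth
    by (intro sum.cong refl arg_cong2[where f = "(*)"] graded_sum_nth assms) auto
  also have "\<dots> = (\<Sum>k\<in>{0..N}. \<Sum>p\<le>N. \<Sum>q\<le>N. \<phi> p $ k * \<chi> q $ (N - k))"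
    by (simp add: sum_product)
  also have "\<dots> = (\<Sum>p\<le>N. \<Sum>k\<in>{0..N}. \<Sum>q\<le>N. \<phi> p $ k * \<chi> q $ (N - k))"
    by (rule sum.swap)
  also have "\<dots> = (\<Sum>p\<le>N. \<Sum>q\<le>N. \<Sum>k\<in>{0..N}. \<phi> p $ k * \<chi> q $ (N - k))"
    by (rule sum.cong[OF refl], rule sum.swap)
  also have "\<dots> = (\<Sum>(p, q)\<in>{..N} \<times> {..N}. (\<phi> p * \<chi> q) $ N)"
    unfolding fps_mult_nth by (rule sum.cartesian_product)
  also have "\<dots> = (\<Sum>(p, q)\<in>{(p, q). p + q \<le> N}. (\<phi> p * \<chi> q) $ N)"
  proof (rule sum.mono_neutral_right)
    show "\<forall>z\<in>{..N} \<times> {..N} - {(p, q). p + q \<le> N}. (case z of (p, q) \<Rightarrow> (\<phi> p * \<chi> q) $ N) = 0"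
    proof
      fix z assume z: "z \<in> {..N} \<times> {..N} - {(p, q). p + q \<le> N}"
      obtain p q where [simp]: "z = (p, q)" by (cases z)
      have pq: "\<not> p + q \<le> N" using z by simp
      have "(\<phi> p * \<chi> q) $ N = 0"
        by (rule fps_mult_nth_eq_0[where p = p and q = q]) (use assms pq in \<open>auto simp: graded_def\<close>)
      then show "(case z of (p, q) \<Rightarrow> (\<phi> p * \<chi> q) $ N) = 0" by simp
    qed
  qed auto
  also have "\<dots> = (\<Sum>n\<le>N. \<Sum>p\<le>n. (\<phi> p * \<chi> (n - p)) $ N)"
    by (rule sum.triangle_reindex_eq)
  also have "\<dots> = graded_sum (\<lambda>n. \<Sum>p\<le>n. \<phi> p * \<chi> (n - p)) $ N"
    by (simp add: graded_sum_def fps_sum_nth)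
  finally show "(graded_sum \<phi> * graded_sum \<chi>) $ N = graded_sum (\<lambda>n. \<Sum>p\<le>n. \<phi> p * \<chi> (n - p)) $ N" .
qed

lemma graded_sum_add: "graded_sum (\<lambda>n. \<phi> n + \<chi> n) = graded_sum \<phi> + graded_sum \<chi>"
  by (rule fps_ext) (simp add: graded_sum_def sum.distrib)

lemma graded_sum_diff: "graded_sum (\<lambda>n. \<phi> n - \<chi> n) = graded_sum \<phi> - graded_sum \<chi>"
  by (rule fps_ext) (simp add: graded_sum_def sum_subtractf)

lemma graded_sum_single:
  assumes "\<And>m. m < k \<Longrightarrow> c $ m = 0"
  shows "graded_sum (\<lambda>n. if n = k then c else 0) = c"
proof (rule fps_ext)
  fix N
  have "(\<Sum>n\<le>N. (if n = k then c else 0) $ N) = (\<Sum>n\<le>N. if n = k then c $ N else 0)"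
    by (intro sum.cong) auto
  then show "graded_sum (\<lambda>n. if n = k then c else 0) $ N = c $ N"
    using assms[of N] by (simp add: graded_sum_def)
qed

lemma graded_sum_shift:
  assumes "graded \<phi>" "\<And>m. m < k \<Longrightarrow> c $ m = 0"
  shows "graded_sum (\<lambda>n. if k \<le> n then c * \<phi> (n - k) else 0) = c * graded_sum \<phi>"
proof -
  have "graded (\<lambda>n. if n = k then c else 0)" using assms(2) by (auto simp: graded_def)
  from graded_sum_mult[OF this assms(1)] have "c * graded_sum \<phi> =
     graded_sum (\<lambda>n. \<Sum>p\<le>n. (if p = k then c else 0) * \<phi> (n - p))"
    by (simp add: graded_sum_single[OF assms(2)])
  also have "(\<lambda>n. \<Sum>p\<le>n. (if p = k then c else 0) * \<phi> (n - p)) = (\<lambda>n. if k \<le> n then c * \<phi> (n - k) else 0)"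
  proof
    fix n
    have "(\<Sum>p\<le>n. (if p = k then c else 0) * \<phi> (n - p)) = (\<Sum>p\<le>n. if p = k then c * \<phi> (n - k) else 0)"
      by (intro sum.cong) auto
    then show "(\<Sum>p\<le>n. (if p = k then c else 0) * \<phi> (n - p)) = (if k \<le> n then c * \<phi> (n - k) else 0)"
      by simp
  qed
  finally show ?thesis by simp
qed

lemma graded_sum_mult_left: "graded \<phi> \<Longrightarrow> graded_sum (\<lambda>n. c * \<phi> n) = c * graded_sum \<phi>"
  using graded_sum_shift[of \<phi> 0 c] by simp

lemma graded_mult_left: "graded \<phi> \<Longrightarrow> graded (\<lambda>n. c * \<phi> n)"
  unfolding graded_def fps_mult_nth by (auto intro!: sum.neutral)

lemma graded_tree_sum:
  fixes x y :: "'a::comm_ring_1 fps"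
  shows "graded (\<lambda>n. tree_sum (fps_X * x) (fps_X * y) u n m)"
  unfolding graded_def
proof (intro allI impI)
  fix n k :: nat assume k: "k < n"
  have "((fps_X * x) ^ nbare t * (fps_X * y) ^ ntip t * u ^ row_len t) $ k = 0" if "t \<in> trees n m" for t
  proof -
    have "(fps_X * x) ^ nbare t * (fps_X * y) ^ ntip t * u ^ row_len t =
      fps_X ^ n * (x ^ nbare t * y ^ ntip t * u ^ row_len t)"
      using that by (auto simp: trees_def power_mult_distrib power_add mult_ac)
    then show ?thesis using k by (simp add: fps_X_power_mult_nth)
  qed
  then show "tree_sum (fps_X * x) (fps_X * y) u n m $ k = 0"
    by (simp add: tree_sum_def fps_sum_nth)
qed

lemma tree_series_equation:
  fixes x y u :: "'a::comm_ring_1 fps"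
  assumes x: "x = fps_X * x'" and y: "y = fps_X * y'"
  defines "W \<equiv> graded_sum (\<lambda>n. tree_sum x y u n 0)"
    and "W1 \<equiv> graded_sum (\<lambda>n. tree_sum x y 1 n 0)"
  shows "(u - 1) * (W - y) = W * u * (x * (u - 1) + W - W1)"
proof -
  let ?w = "\<lambda>n. tree_sum x y u n 0" and ?w1 = "\<lambda>n. tree_sum x y 1 n 0"
  have g: "graded ?w" "graded ?w1" unfolding x y by (rule graded_tree_sum)+
  have gd: "graded (\<lambda>n. ?w n - ?w1 n)" using g by (simp add: graded_def)
  have gy: "graded (\<lambda>n. if n = 1 then y else 0)" using y by (auto simp: graded_def)
  have x0: "m < 1 \<Longrightarrow> x $ m = 0" for m using x by simp
  have y0: "m < 1 \<Longrightarrow> y $ m = 0" for m using y by simp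
  have "(u - 1) * W = graded_sum (\<lambda>n. (u - 1) * ?w n)"
    unfolding W_def by (simp add: graded_sum_mult_left[OF g(1)])
  also have "(\<lambda>n. (u - 1) * ?w n) = (\<lambda>n. (u - 1) * (if n = 1 then y else 0) +
     (if 1 \<le> n then x * (((u - 1) * u) * ?w (n - 1)) else 0) +
     u * (\<Sum>p\<le>n. (?w p - ?w1 p) * ?w (n - p)))"
    by (rule ext) (subst tree_sum_equation, auto simp: mult_ac)
  also have "graded_sum \<dots> = (u - 1) * y + x * (((u - 1) * u) * W) + u * ((W - W1) * W)"
  proof -
    have "graded (\<lambda>n. \<Sum>p\<le>n. (?w p - ?w1 p) * ?w (n - p))"
      unfolding graded_def
    proof (intro allI impI)
      fix n m :: nat assume "m < n"
      have "((?w p - ?w1 p) * ?w (n - p)) $ m = 0" if "p \<le> n" for p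
        by (rule fps_mult_nth_eq_0[where p = p and q = "n - p"])
           (use gd g(1) \<open>m < n\<close> that in \<open>auto simp: graded_def\<close>)
      then show "(\<Sum>p\<le>n. (?w p - ?w1 p) * ?w (n - p)) $ m = 0" by (simp add: fps_sum_nth)
    qed
    then have 1: "graded_sum (\<lambda>n. u * (\<Sum>p\<le>n. (?w p - ?w1 p) * ?w (n - p))) = u * ((W - W1) * W)"
      by (simp add: graded_sum_mult_left graded_sum_mult[OF gd g(1), symmetric] graded_sum_diff W_def W1_def)
    have 2: "graded_sum (\<lambda>n. if 1 \<le> n then x * (((u - 1) * u) * ?w (n - 1)) else 0) = x * (((u - 1) * u) * W)"
      unfolding W_def graded_sum_mult_left[OF g(1), symmetric]
      by (rule graded_sum_shift[OF graded_mult_left[OF g(1)] x0])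
    have 3: "graded_sum (\<lambda>n. (u - 1) * (if n = 1 then y else 0)) = (u - 1) * y"
      by (simp only: graded_sum_mult_left[OF gy] graded_sum_single[OF y0])
    show ?thesis unfolding graded_sum_add 1 2 3 ..
  qed
  finally show ?thesis by (simp add: algebra_simps)
qed

section \<open>Solution of the functional equation\<close>

text \<open>In \<open>'a fps fps\<close> the outer variable carries the grading and the inner one
  the parameter behind \<open>u\<close>. Lifted series are those free of the parameter, such as
  \<open>W1\<close>.\<close>

definition lift_fps :: "'a::comm_ring_1 fps \<Rightarrow> 'a fps fps" where
  "lift_fps f = Abs_fps (\<lambda>n. fps_const (f $ n))"

lemma lift_fps_nth [simp]: "lift_fps f $ n = fps_const (f $ n)"
  by (simp add: lift_fps_def)

lemma fps_const_sum: "fps_const (sum f A) = (\<Sum>a\<in>A. fps_const (f a))"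
  by (induction A rule: infinite_finite_induct) (auto simp flip: fps_const_add)

lemma lift_fps_hom:
  "lift_fps (f + g) = lift_fps f + lift_fps g"
  "lift_fps (f - g) = lift_fps f - lift_fps g"
  "lift_fps (f * g) = lift_fps f * lift_fps g"
  "lift_fps 1 = 1" "lift_fps 0 = 0"
  "lift_fps fps_X = fps_X"
  by (rule fps_ext; simp add: fps_mult_nth fps_const_sum fps_X_def; fail)+

lemma lift_fps_power: "lift_fps (f ^ n) = lift_fps f ^ n"
  by (induction n) (simp_all add: lift_fps_hom)

lemma lift_fps_sum: "lift_fps (sum f A) = (\<Sum>a\<in>A. lift_fps (f a))"
  by (induction A rule: infinite_finite_induct) (simp_all add: lift_fps_hom)

text \<open>A formal version of the kernel method. Comparing lowest coefficients, a discrepancy \<open>e\<close> in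
  \<open>W1\<close> would make \<open>fps_X\<close> divide a nonzero constant.\<close>

lemma catalytic_unique:
  fixes x y u W W' :: "real fps fps" and W1 W1' :: "real fps"
  assumes eq: "(u - 1) * (W - y) = W * u * (x * (u - 1) + W - lift_fps W1)"
    and eq': "(u - 1) * (W' - y) = W' * u * (x * (u - 1) + W' - lift_fps W1')"
    and u0: "u $ 0 = 1 + fps_X"
    and zero: "x $ 0 = 0" "W $ 0 = 0" "W' $ 0 = 0" "W1 $ 0 = 0"
    and W1: "W' $ 1 = fps_const c" "c \<noteq> 0"
  shows "W1 = W1'"
proof -
  define E where "E = W - W'"
  define e where "e = lift_fps (W1 - W1')"
  define R where "R = u * (x * (u - 1) + W - lift_fps W1)"
  have key: "(u - 1) * E = E * R + (W' * u) * (E - e)"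
  proof -
    have "(u - 1) * E = (u - 1) * (W - y) - (u - 1) * (W' - y)" by (simp add: E_def algebra_simps)
    also have "\<dots> = E * R + (W' * u) * (E - e)"
      unfolding eq eq' by (simp add: E_def e_def R_def lift_fps_hom algebra_simps)
    finally show ?thesis .
  qed
  have R0: "R $ 0 = 0" using zero by (simp add: R_def fps_mult_nth)
  have V0: "(W' * u) $ 0 = 0" using zero by (simp add: fps_mult_nth)
  have V1: "(W' * u) $ 1 = fps_const c * (1 + fps_X)" using zero W1 u0 by (simp add: fps_mult_nth)
  have "(W1 - W1') $ d = 0" for d
  proof (induction d rule: less_induct)
    case (less d)
    have e_lt: "e $ k = 0" if "k < d" for k using less[OF that] by (simp add: e_def)
    \<comment> \<open>At order \<open>k\<close> the right side of \<open>key\<close> involves only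
      lower coefficients of \<open>E\<close> and \<open>e\<close>, which vanish; the left side is
      \<open>fps_X * E $ k\<close>, where \<open>fps_X\<close> is the lowest coefficient of
      \<open>u - 1\<close> and can be cancelled.\<close>
    have E_le: "k \<le> d \<Longrightarrow> E $ k = 0" for k
    proof (induction k rule: less_induct)
      case (less k)
      have lt: "E $ l = 0" if "l < k" for l using less that by simp
      have "(E * R) $ k = 0"
        by (rule fps_mult_nth_eq_0[where p = k and q = 1]) (use lt R0 in auto)
      moreover have "((W' * u) * (E - e)) $ k = 0"
        by (rule fps_mult_nth_eq_0[where p = 1 and q = k]) (use lt V0 e_lt less.prems in auto)
      moreover have "((u - 1) * E) $ k = (u - 1) $ 0 * E $ k"
      proof -
        have "((u - 1) * E) $ k = (\<Sum>i\<in>{0}. (u - 1) $ i * E $ (k - i))"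
          unfolding fps_mult_nth by (rule sum.mono_neutral_right) (use lt in auto)
        then show ?thesis by simp
      qed
      ultimately have "(u - 1) $ 0 * E $ k = 0" using key by simp
      then show ?case using u0 by simp
    qed
    have "(E * R) $ Suc d = 0"
      by (rule fps_mult_nth_eq_0[where p = "Suc d" and q = 1]) (use E_le R0 in auto)
    moreover have "((W' * u) * (E - e)) $ Suc d = - (fps_const c * (1 + fps_X) * e $ d)"
    proof -
      have "((W' * u) * (E - e)) $ Suc d = (\<Sum>i\<in>{1}. (W' * u) $ i * (E - e) $ (Suc d - i))"
        unfolding fps_mult_nth[of "W' * u" "E - e"]
      proof (rule sum.mono_neutral_right)
        show "\<forall>i\<in>{0..Suc d} - {1}. (W' * u) $ i * (E - e) $ (Suc d - i) = 0"
        proof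
          fix i assume "i \<in> {0..Suc d} - {1}"
          then have "i = 0 \<or> Suc d - i < d" by auto
          then show "(W' * u) $ i * (E - e) $ (Suc d - i) = 0" using V0 e_lt E_le by auto
        qed
      qed auto
      then show ?thesis using V1 E_le[of d] by simp
    qed
    moreover have "((u - 1) * E) $ Suc d = fps_X * E $ Suc d"
    proof -
      have "((u - 1) * E) $ Suc d = (\<Sum>i\<in>{0}. (u - 1) $ i * E $ (Suc d - i))"
        unfolding fps_mult_nth by (rule sum.mono_neutral_right) (use E_le in auto)
      then show ?thesis using u0 by simp
    qed
    ultimately have "fps_X * E $ Suc d = - (fps_const c * (1 + fps_X) * e $ d)" using key by simp
    then have "(fps_X * E $ Suc d) $ 0 = (- (fps_const c * (1 + fps_X) * e $ d)) $ 0" by simp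
    then have "c * (W1 - W1') $ d = 0" by (simp add: e_def)
    then show ?case using W1(2) by simp
  qed
  then show ?thesis by (simp add: fps_eq_iff)
qed

lemma fps_unit:
  fixes f :: "'a::comm_ring_1 fps"
  assumes "f $ 0 = 1"
  obtains g where "g * f = 1"
  using fps_left_inverse[of 1 f] assms by auto

text \<open>The discriminant of the quadratic equation for \<open>W\<close> is a square times a quadratic polynomial in
  \<open>u\<close>; the parameter \<open>k\<close> below rationalizes the square root of the latter.\<close>

lemma tree_series_parametrization:
  fixes r s x y :: "real fps"
  assumes r: "r = fps_const \<alpha> * fps_X" and s: "s = fps_X"
    and x: "x = r * (1 - s)\<^sup>2" and y: "y = s * (1 - r)\<^sup>2"
  shows "graded_sum (\<lambda>n. tree_sum x y 1 n 0) = s * (1 - r - r * s)"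
proof -
  define R S X Y where "R = lift_fps r" "S = lift_fps s" "X = lift_fps x" "Y = lift_fps y"
  define k :: "real fps fps" where "k = fps_const (1 + fps_X)"
  \<comment> \<open>With \<open>S\<close> and \<open>R\<close> for \<open>s\<close> and
    \<open>r\<close>, the discriminant in \<open>W\<close> is
    \<open>(1 - (1 - S) u)^2 * ((1 - (a + b) u)^2 - 4 a b u^2)\<close>; this is the origin of
    \<open>a\<close> and \<open>b\<close>.\<close>
  define a where "a = R * (1 - R * S)"
  define b where "b = R * S * (1 - R)"
  have R0: "R $ 0 = 0" "S $ 0 = 0" using r s by (simp_all add: R_S_X_Y_def)
  obtain p where p: "p * (1 + a * k) = 1"
    by (rule fps_unit[of "1 + a * k"]) (simp add: a_def R0)
  obtain q where q: "q * (1 + b * k) = 1"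
    by (rule fps_unit[of "1 + b * k"]) (simp add: b_def R0)
  \<comment> \<open>That is, \<open>1 / u = 1 / k + (a + b) + a b k\<close>, which turns the second
    factor of the discriminant into the square of \<open>u (1 / k - a b k)\<close>.\<close>
  define u where "u = k * p * q"
  \<comment> \<open>Of the two roots of the quadratic, this is the one with zero constant
    term.\<close>
  define W' where "W' = Y - a * b * k + (1 - S) * b * k * q"
  have XY: "X = R * (1 - S)^2" "Y = S * (1 - R)^2"
    using x y by (simp_all add: R_S_X_Y_def lift_fps_hom lift_fps_power)
  have eq': "(u - 1) * (W' - Y) = W' * u * (X * (u - 1) + W' - S * (1 - R - R * S))"
    using p q XY a_def b_def u_def W'_def by algebra
  define cA where "cA = lift_fps (fps_const \<alpha>)"
  have R: "R = fps_X * cA" and S: "S = fps_X"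
    using r s by (simp_all add: R_S_X_Y_def cA_def lift_fps_hom mult.commute)
  define W where "W = graded_sum (\<lambda>n. tree_sum X Y u n 0)"
  define W1 where "W1 = graded_sum (\<lambda>n. tree_sum x y 1 n 0)"
  have lift_W1: "graded_sum (\<lambda>n. tree_sum X Y 1 n 0) = lift_fps W1"
  proof (rule fps_ext)
    fix N
    have "tree_sum X Y 1 n 0 = lift_fps (tree_sum x y 1 n 0)" for n
      by (simp add: tree_sum_def lift_fps_sum lift_fps_hom lift_fps_power R_S_X_Y_def)
    then show "graded_sum (\<lambda>n. tree_sum X Y 1 n 0) $ N = lift_fps W1 $ N"
      by (simp add: graded_sum_def W1_def fps_const_sum)
  qed
  have X': "X = fps_X * (cA * (1 - S)^2)" and Y': "Y = fps_X * (1 - R)^2"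
    unfolding XY R S by (simp_all add: mult_ac)
  have eq: "(u - 1) * (W - Y) = W * u * (X * (u - 1) + W - lift_fps W1)"
    using tree_series_equation[OF X' Y', of u] unfolding W_def lift_W1 .
  have p0: "p $ 0 = 1" using arg_cong[OF p, of "\<lambda>f. f $ 0"] by (simp add: a_def R0)
  have q0: "q $ 0 = 1" using arg_cong[OF q, of "\<lambda>f. f $ 0"] by (simp add: b_def R0)
  \<comment> \<open>\<open>b\<close> contains the factor \<open>R * S\<close> of order 2, so the
    coefficient of \<open>W'\<close> at order 1 is that of \<open>Y\<close>, namely 1.\<close>
  have W': "W' = fps_X * (1 - R)^2 + fps_X ^ 2 * (cA * (1 - R) * (k * ((1 - S) * q - a)))"
    unfolding W'_def Y' b_def by (simp add: R S power2_eq_square algebra_simps)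
  have "W1 = s * (1 - r - r * s)"
  proof (rule catalytic_unique[OF eq])
    show "(u - 1) * (W' - Y) = W' * u * (X * (u - 1) + W' - lift_fps (s * (1 - r - r * s)))"
      using eq' by (simp add: lift_fps_hom R_S_X_Y_def)
    show "u $ 0 = 1 + fps_X" by (simp add: u_def k_def p0 q0)
    show "X $ 0 = 0" by (simp add: X')
    show "W $ 0 = 0" "W1 $ 0 = 0" by (simp_all add: W_def W1_def graded_sum_def)
    show "W' $ 0 = 0" by (simp add: W' fps_X_power_mult_nth)
    show "W' $ 1 = fps_const 1" by (simp add: W' fps_X_power_mult_nth R power2_eq_square)
  qed simp
  then show ?thesis by (simp add: W1_def)
qed

section \<open>Lagrange inversion\<close>

text \<open>The coefficient of \<open>z ^ p\<close> in \<open>z ^ i * (1 - z) powr a\<close>.\<close>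

definition pcoeff :: "real \<Rightarrow> nat \<Rightarrow> nat \<Rightarrow> real" where
  "pcoeff a p i = (if i \<le> p then (- 1) ^ (p - i) * (a gchoose (p - i)) else 0)"

text \<open>Multiplication of \<open>z ^ i * (1 - z) powr a\<close> by
  \<open>z ^ t * (1 - z) powr b\<close>, read coefficientwise; it reduces to Vandermonde's
  identity.\<close>

lemma pcoeff_convolution: "(\<Sum>p\<le>m. pcoeff a p i * pcoeff b m (p + t)) = pcoeff (a + b) m (i + t)"
proof (cases "i + t \<le> m")
  case True
  define d where "d = m - (i + t)"
  have m: "m = i + t + d" using True by (simp add: d_def)
  have "(\<Sum>p\<le>m. pcoeff a p i * pcoeff b m (p + t)) =
    (\<Sum>p\<in>{i..i + d}. pcoeff a p i * pcoeff b m (p + t))"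
    by (rule sum.mono_neutral_right) (auto simp: pcoeff_def m)
  also have "\<dots> = (\<Sum>l\<in>{0..d}. pcoeff a (l + i) i * pcoeff b m (l + i + t))"
    using sum.shift_bounds_cl_nat_ivl[of "\<lambda>p. pcoeff a p i * pcoeff b m (p + t)" 0 i d]
    by (simp add: add.commute)
  also have "\<dots> = (\<Sum>l\<in>{0..d}. (- 1) ^ d * ((a gchoose l) * (b gchoose (d - l))))"
  proof (intro sum.cong refl)
    fix l assume "l \<in> {0..d}"
    then have "(- 1 :: real) ^ d = (- 1) ^ l * (- 1) ^ (d - l)" by (simp flip: power_add)
    moreover have "m - (l + i + t) = d - l" using m by simp
    ultimately show "pcoeff a (l + i) i * pcoeff b m (l + i + t) =
      (- 1) ^ d * ((a gchoose l) * (b gchoose (d - l)))"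
      using \<open>l \<in> {0..d}\<close> m by (simp add: pcoeff_def)
  qed
  also have "\<dots> = (- 1) ^ d * ((a + b) gchoose d)"
    by (simp flip: sum_distrib_left add: gbinomial_Vandermonde)
  finally show ?thesis by (simp add: pcoeff_def m)
next
  case False
  then have "pcoeff a p i * pcoeff b m (p + t) = 0" for p by (auto simp: pcoeff_def)
  then have "(\<Sum>p\<le>m. pcoeff a p i * pcoeff b m (p + t)) = 0" by (intro sum.neutral ballI)
  then show ?thesis using False by (simp add: pcoeff_def[of _ m "i + t"])
qed

text \<open>Coefficient form of the derivative of \<open>(1 - z) powr a\<close>, which is
  \<open>- a (1 - z) powr (a - 1)\<close>.\<close>

lemma pcoeff_absorb:
  "i \<le> m \<Longrightarrow> real (m - i) * pcoeff a m i = - a * pcoeff (a - 1) m (Suc i)"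
proof (cases "m - i")
  case (Suc k)
  then have "m - Suc i = k" "Suc i \<le> m" "i \<le> m" by auto
  then show ?thesis using gbinomial_absorption[of k a] Suc by (simp add: pcoeff_def)
qed (simp add: pcoeff_def)

text \<open>Recurrence between neighbouring coefficients of \<open>f = (1 - z) powr a\<close>, from
  \<open>(1 - z) f' = - a f\<close>.\<close>

lemma pcoeff_step:
  "i < m \<Longrightarrow> real (m - i) * pcoeff a m i = (real (m - Suc i) - a) * pcoeff a m (Suc i)"
proof -
  assume "i < m"
  then obtain k where k: "m - i = Suc k" "m - Suc i = k" by (metis Suc_diff_Suc)
  have abs: "real (Suc k) * (a gchoose Suc k) = (a - real k) * (a gchoose k)"
    using gbinomial_mult_1[of a k] by (simp add: algebra_simps)
  have "real (Suc k) * ((- 1) ^ Suc k * (a gchoose Suc k)) = (- 1) ^ Suc k * (real (Suc k) * (a gchoose Suc k))"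
    by (simp only: mult_ac)
  also have "\<dots> = (real k - a) * ((- 1) ^ k * (a gchoose k))"
    unfolding abs by (simp add: algebra_simps)
  finally have "real (Suc k) * ((- 1) ^ Suc k * (a gchoose Suc k)) = (real k - a) * ((- 1) ^ k * (a gchoose k))" .
  then show ?thesis using k \<open>i < m\<close> by (simp only: pcoeff_def) simp
qed

text \<open>The coefficient of \<open>r ^ m * s ^ n\<close> in
  \<open>r ^ p * s ^ q * (1 - s) powr (- 2 * m) * (1 - r) powr (- 2 * n) * (1 - 4 * r * s / ((1 - r) * (1 - s)))\<close>,
  where the last factor comes from the Jacobian of \<open>x = r (1 - s)^2\<close>, \<open>y = s (1 - r)^2\<close>.\<close>

definition lagrange_coeff :: "nat \<Rightarrow> nat \<Rightarrow> nat \<Rightarrow> nat \<Rightarrow> real" where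
  "lagrange_coeff m n p q = pcoeff (- 2 * real n) m p * pcoeff (- 2 * real m) n q -
     4 * (pcoeff (- 2 * real n - 1) m (p + 1) * pcoeff (- 2 * real m - 1) n (q + 1))"

text \<open>Since \<open>x ^ i * y ^ j\<close> splits as \<open>r ^ i * (1 - r) ^ (2 * j)\<close>
  times \<open>s ^ j * (1 - s) ^ (2 * i)\<close>, both parts of \<open>lagrange_coeff\<close> factor
  into convolutions in one variable.\<close>

lemma lagrange_orthogonal:
  assumes "i \<le> m" "j \<le> n"
  shows "(\<Sum>p\<le>m. \<Sum>q\<le>n. pcoeff (2 * real j) p i * pcoeff (2 * real i) q j * lagrange_coeff m n p q) =
    (if i = m \<and> j = n then 1 else 0)"
proof -
  have "(\<Sum>p\<le>m. \<Sum>q\<le>n. pcoeff (2 * real j) p i * pcoeff (2 * real i) q j * lagrange_coeff m n p q) =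
    (\<Sum>p\<le>m. pcoeff (2 * real j) p i * pcoeff (- 2 * real n) m (p + 0)) *
    (\<Sum>q\<le>n. pcoeff (2 * real i) q j * pcoeff (- 2 * real m) n (q + 0)) -
    4 * ((\<Sum>p\<le>m. pcoeff (2 * real j) p i * pcoeff (- 2 * real n - 1) m (p + 1)) *
    (\<Sum>q\<le>n. pcoeff (2 * real i) q j * pcoeff (- 2 * real m - 1) n (q + 1)))"
    by (simp add: sum_product sum_distrib_left lagrange_coeff_def algebra_simps sum_subtractf)
  also have "\<dots> = pcoeff (2 * real j - 2 * real n) m i * pcoeff (2 * real i - 2 * real m) n j -
    4 * (pcoeff (2 * real j - 2 * real n - 1) m (Suc i) * pcoeff (2 * real i - 2 * real m - 1) n (Suc j))"
    unfolding pcoeff_convolution by (simp add: algebra_simps)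
  also have "\<dots> = (if i = m \<and> j = n then 1 else 0)"
  proof (cases "i < m \<and> j < n")
    case True
    let ?a = "2 * real j - 2 * real n" and ?b = "2 * real i - 2 * real m"
    \<comment> \<open>Each exponent involves the other variable's index: absorption puts
      \<open>2 * (n - j)\<close> against \<open>m - i\<close> here and the reverse below, so in the
      product these factors cancel up to the 4 of the Jacobian.\<close>
    have 1: "real (m - i) * pcoeff ?a m i = 2 * real (n - j) * pcoeff (?a - 1) m (Suc i)"
      using pcoeff_absorb[OF assms(1), of ?a] assms by (simp add: of_nat_diff)
    have 2: "real (n - j) * pcoeff ?b n j = 2 * real (m - i) * pcoeff (?b - 1) n (Suc j)"
      using pcoeff_absorb[OF assms(2), of ?b] assms by (simp add: of_nat_diff)
    have "real (m - i) * real (n - j) * (pcoeff ?a m i * pcoeff ?b n j) =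
      (real (m - i) * pcoeff ?a m i) * (real (n - j) * pcoeff ?b n j)" by simp
    also have "\<dots> = real (m - i) * real (n - j) * (4 * (pcoeff (?a - 1) m (Suc i) * pcoeff (?b - 1) n (Suc j)))"
      unfolding 1 2 by simp
    finally have "pcoeff ?a m i * pcoeff ?b n j = 4 * (pcoeff (?a - 1) m (Suc i) * pcoeff (?b - 1) n (Suc j))"
      using True by simp
    then show ?thesis using True by simp
  next
    case False
    \<comment> \<open>If just one index agrees, an exponent is 0 and both products vanish; if both
      agree, only the first product survives.\<close>
    have zero: "pcoeff 0 p k = (if p = k then 1 else 0)" for p k
      by (cases "p - k") (auto simp: pcoeff_def)
    show ?thesis
      using False assms by (cases "i = m"; cases "j = n") (auto simp: zero pcoeff_def[of _ m "Suc m"] pcoeff_def[of _ n "Suc n"] pcoeff_def[of _ m m] pcoeff_def[of _ n n])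
  qed
  finally show ?thesis .
qed

section \<open>Extraction of bivariate coefficients\<close>

lemma one_minus_power_nth:
  "((1 - fps_const c * fps_X) ^ n) $ k = (- c) ^ k * (real n gchoose k)"
proof (cases "c = 0")
  case True
  then show ?thesis by (cases k) auto
next
  case False
  have "- fps_const c * fps_X = fps_const (- c) * fps_X" by simp
  then show ?thesis
    unfolding one_minus_const_fps_X_power[OF False] by (simp only: fps_compose_linear fps_nth_Abs_fps fps_binomial_nth)
qed

lemma monomial_nth:
  fixes \<alpha> :: real
  defines "r \<equiv> fps_const \<alpha> * fps_X" and "s \<equiv> fps_X"
  assumes "i + j \<le> N"
  shows "((r * (1 - s)\<^sup>2) ^ i * (s * (1 - r)\<^sup>2) ^ j) $ N =
    (\<Sum>p\<le>N. pcoeff (2 * real j) p i * pcoeff (2 * real i) (N - p) j * \<alpha> ^ p)"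
proof -
  define d where "d = N - (i + j)"
  have N: "N = i + j + d" using assms by (simp add: d_def)
  have s': "1 - s = 1 - fps_const 1 * fps_X" by (simp add: s_def)
  have "(r * (1 - s)\<^sup>2) ^ i * (s * (1 - r)\<^sup>2) ^ j =
    fps_const (\<alpha> ^ i) * (fps_X ^ (i + j) * ((1 - r) ^ (2 * j) * (1 - s) ^ (2 * i)))"
    by (simp add: r_def s_def power_mult_distrib power_add mult_ac fps_const_power flip: power_mult)
  then have "((r * (1 - s)\<^sup>2) ^ i * (s * (1 - r)\<^sup>2) ^ j) $ N =
    \<alpha> ^ i * ((1 - r) ^ (2 * j) * (1 - s) ^ (2 * i)) $ d"
    by (simp add: fps_X_power_mult_nth N)
  also have "\<dots> = (\<Sum>l\<in>{0..d}. \<alpha> ^ i * (((- \<alpha>) ^ l * (2 * real j gchoose l)) *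
      ((- 1) ^ (d - l) * (2 * real i gchoose (d - l)))))"
    unfolding s' r_def fps_mult_nth[of "(1 - _) ^ _"] one_minus_power_nth by (simp add: sum_distrib_left)
  also have "\<dots> = (\<Sum>l\<in>{0..d}. pcoeff (2 * real j) (l + i) i * pcoeff (2 * real i) (N - (l + i)) j * \<alpha> ^ (l + i))"
  proof (intro sum.cong refl)
    fix l assume "l \<in> {0..d}"
    then have "N - (l + i) = j + (d - l)" using N by simp
    then show "\<alpha> ^ i * (((- \<alpha>) ^ l * (2 * real j gchoose l)) * ((- 1) ^ (d - l) * (2 * real i gchoose (d - l)))) =
      pcoeff (2 * real j) (l + i) i * pcoeff (2 * real i) (N - (l + i)) j * \<alpha> ^ (l + i)"
      by (simp add: pcoeff_def power_add power_minus[of \<alpha>])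
  qed
  also have "\<dots> = (\<Sum>p\<in>{i..i + d}. pcoeff (2 * real j) p i * pcoeff (2 * real i) (N - p) j * \<alpha> ^ p)"
    using sum.shift_bounds_cl_nat_ivl[of "\<lambda>p. pcoeff (2 * real j) p i * pcoeff (2 * real i) (N - p) j * \<alpha> ^ p" 0 i d]
    by (simp add: add.commute)
  also have "\<dots> = (\<Sum>p\<le>N. pcoeff (2 * real j) p i * pcoeff (2 * real i) (N - p) j * \<alpha> ^ p)"
    by (rule sum.mono_neutral_left) (auto simp: pcoeff_def N)
  finally show ?thesis .
qed

text \<open>The coefficients of \<open>s * (1 - r - r * s)\<close> in \<open>r\<close> and \<open>s\<close>.\<close>

definition target_coeff :: "nat \<Rightarrow> nat \<Rightarrow> real" where
  "target_coeff p q = (if p = 0 \<and> q = 1 then 1 else if p = 1 \<and> (q = 1 \<or> q = 2) then - 1 else 0)"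

lemma target_nth:
  fixes \<alpha> :: real
  defines "r \<equiv> fps_const \<alpha> * fps_X" and "s \<equiv> fps_X"
  shows "(s * (1 - r - r * s)) $ N = (\<Sum>p\<le>N. target_coeff p (N - p) * \<alpha> ^ p)"
proof -
  have "s * (1 - r - r * s) = fps_X - fps_const \<alpha> * fps_X ^ 2 - fps_const \<alpha> * fps_X ^ 3"
    by (simp add: r_def s_def algebra_simps power2_eq_square power3_eq_cube)
  then have "(s * (1 - r - r * s)) $ N = (if N = 1 then 1 else 0) - (if N = 2 then \<alpha> else 0) - (if N = 3 then \<alpha> else 0)"
    by (simp add: fps_X_nth fps_X_power_nth)
  also have "\<dots> = (\<Sum>p\<le>N. target_coeff p (N - p) * \<alpha> ^ p)"
  proof (cases "N \<in> {1, 2, 3}")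
    case True
    then show ?thesis by (auto simp: target_coeff_def numeral_2_eq_2 numeral_3_eq_3)
  next
    case False
    then have "target_coeff p (N - p) = 0" for p by (auto simp: target_coeff_def)
    then show ?thesis using False by simp
  qed
  finally show ?thesis .
qed

text \<open>Compares coefficients of \<open>r ^ p * s ^ q\<close> in the parametrized series.
  \<open>pcoeff\<close> vanishes for trees whose statistics exceed \<open>p\<close> or
  \<open>q\<close>, so \<open>T\<close> may be any finite set containing the remaining ones.\<close>

lemma tree_coefficient_equation:
  fixes p q :: nat
  assumes T: "finite T" "\<And>t. t \<in> T \<Longrightarrow> valid 0 t"
    "\<And>t. valid 0 t \<Longrightarrow> nbare t \<le> p \<Longrightarrow> ntip t \<le> q \<Longrightarrow> t \<in> T"
  shows "(\<Sum>t\<in>T. pcoeff (2 * real (ntip t)) p (nbare t) * pcoeff (2 * real (nbare t)) q (ntip t)) =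
    target_coeff p q"
proof -
  define N where "N = p + q"
  define A where "A = (\<Union>n\<le>N. trees n 0)"
  let ?f = "\<lambda>p q t. pcoeff (2 * real (ntip t)) p (nbare t) * pcoeff (2 * real (nbare t)) q (ntip t)"
  have A: "finite A" "\<And>t. t \<in> A \<longleftrightarrow> valid 0 t \<and> nbare t + ntip t \<le> N"
    by (simp add: A_def finite_trees) (auto simp: A_def trees_def)
  have "(\<Sum>p\<le>N. (\<Sum>t\<in>A. ?f p (N - p) t) * \<alpha> ^ p) = (\<Sum>p\<le>N. target_coeff p (N - p) * \<alpha> ^ p)" for \<alpha>
  proof -
    define r s :: "real fps" where "r = fps_const \<alpha> * fps_X" and "s = fps_X"
    define x y where "x = r * (1 - s)\<^sup>2" and "y = s * (1 - r)\<^sup>2"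
    have "(\<Sum>p\<le>N. target_coeff p (N - p) * \<alpha> ^ p) = (s * (1 - r - r * s)) $ N"
      unfolding r_def s_def by (rule target_nth[symmetric])
    also have "\<dots> = graded_sum (\<lambda>n. tree_sum x y 1 n 0) $ N"
      using tree_series_parametrization[OF r_def s_def x_def y_def] by simp
    also have "\<dots> = (\<Sum>n\<le>N. \<Sum>t\<in>trees n 0. (x ^ nbare t * y ^ ntip t) $ N)"
      by (simp add: graded_sum_def tree_sum_def fps_sum_nth)
    also have "\<dots> = (\<Sum>t\<in>A. (x ^ nbare t * y ^ ntip t) $ N)"
      unfolding A_def by (rule sum.UNION_disjoint[symmetric], simp, simp add: finite_trees, auto simp: trees_def)
    also have "\<dots> = (\<Sum>t\<in>A. \<Sum>p\<le>N. ?f p (N - p) t * \<alpha> ^ p)"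
      unfolding x_def y_def r_def s_def by (intro sum.cong refl monomial_nth) (simp add: A)
    also have "\<dots> = (\<Sum>p\<le>N. (\<Sum>t\<in>A. ?f p (N - p) t) * \<alpha> ^ p)"
      by (subst sum.swap) (simp add: sum_distrib_right)
    finally show ?thesis ..
  qed
  \<comment> \<open>Two polynomials in \<alpha> that agree at every real number have equal
    coefficients; this separates the powers of \<open>r\<close> and \<open>s\<close>.\<close>
  then have "\<forall>p\<le>N. (\<Sum>t\<in>A. ?f p (N - p) t) = target_coeff p (N - p)"
    by (subst polyfun_eq_coeffs[symmetric]) blast
  from this[rule_format, of p] have "(\<Sum>t\<in>A. ?f p q t) = target_coeff p q" by (simp add: N_def)
  moreover have "(\<Sum>t\<in>A. ?f p q t) = (\<Sum>t\<in>A \<inter> T. ?f p q t)"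
    by (rule sum.mono_neutral_right) (use A T(3) in \<open>auto simp: pcoeff_def\<close>)
  moreover have "(\<Sum>t\<in>T. ?f p q t) = (\<Sum>t\<in>A \<inter> T. ?f p q t)"
    by (rule sum.mono_neutral_right) (use A T in \<open>auto simp: pcoeff_def N_def\<close>)
  ultimately show ?thesis by simp
qed

text \<open>Pairing the coefficient equations with \<open>lagrange_coeff m n\<close> lets
  orthogonality keep only the trees with statistics \<open>m\<close> and \<open>n\<close>, each
  counted once.\<close>

lemma card_trees_lagrange:
  "real (card {t. valid 0 t \<and> nbare t = m \<and> ntip t = n}) =
    (\<Sum>p\<le>m. \<Sum>q\<le>n. target_coeff p q * lagrange_coeff m n p q)"
proof -
  define T where "T = {t. valid 0 t \<and> nbare t \<le> m \<and> ntip t \<le> n}"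
  let ?f = "\<lambda>p q t. pcoeff (2 * real (ntip t)) p (nbare t) * pcoeff (2 * real (nbare t)) q (ntip t)"
  have "T \<subseteq> (\<Union>k\<le>m + n. trees k 0)" by (auto simp: T_def trees_def)
  then have T: "finite T" using finite_subset by (fastforce simp: finite_trees)
  have "(\<Sum>p\<le>m. \<Sum>q\<le>n. target_coeff p q * lagrange_coeff m n p q) =
    (\<Sum>p\<le>m. \<Sum>q\<le>n. \<Sum>t\<in>T. ?f p q t * lagrange_coeff m n p q)"
  proof (intro sum.cong refl)
    fix p q assume "p \<in> {..m}" "q \<in> {..n}"
    then have "(\<Sum>t\<in>T. ?f p q t) = target_coeff p q"
      by (intro tree_coefficient_equation T) (auto simp: T_def)
    then show "target_coeff p q * lagrange_coeff m n p q = (\<Sum>t\<in>T. ?f p q t * lagrange_coeff m n p q)"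
      by (simp flip: sum_distrib_right)
  qed
  also have "\<dots> = (\<Sum>p\<le>m. \<Sum>t\<in>T. \<Sum>q\<le>n. ?f p q t * lagrange_coeff m n p q)"
    by (rule sum.cong[OF refl], rule sum.swap)
  also have "\<dots> = (\<Sum>t\<in>T. \<Sum>p\<le>m. \<Sum>q\<le>n. ?f p q t * lagrange_coeff m n p q)"
    by (rule sum.swap)
  also have "\<dots> = (\<Sum>t\<in>T. if nbare t = m \<and> ntip t = n then 1 else 0)"
    by (intro sum.cong refl lagrange_orthogonal) (auto simp: T_def)
  also have "\<dots> = real (card {t \<in> T. nbare t = m \<and> ntip t = n})"
    using T by (simp add: sum.If_cases Int_def)
  also have "{t \<in> T. nbare t = m \<and> ntip t = n} = {t. valid 0 t \<and> nbare t = m \<and> ntip t = n}"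
    by (auto simp: T_def)
  finally show ?thesis by simp
qed

lemma pcoeff_minus: "i \<le> m \<Longrightarrow> 0 < a \<Longrightarrow> pcoeff (- real a) m i = real ((a + (m - i) - 1) choose (m - i))"
proof -
  assume *: "i \<le> m" "0 < a"
  have "real (a + (m - i) - 1) = real a + real (m - i) - 1" using * by simp
  then show ?thesis
    using * by (simp only: pcoeff_def gbinomial_minus binomial_gbinomial) (simp flip: power_mult_distrib mult.assoc)
qed

text \<open>By absorption the Jacobian part is a rational multiple of the main part; the two
  denominators \<open>2 * n\<close> and \<open>2 * m\<close> cancel the 4.\<close>

lemma lagrange_coeff_eq:
  assumes "0 < m" "0 < n" "p \<le> m" "q \<le> n"
  shows "lagrange_coeff m n p q = pcoeff (- 2 * real n) m p * pcoeff (- 2 * real m) n q *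
    (1 - real (m - p) * real (n - q) / (real m * real n))"
proof -
  have 1: "pcoeff (- 2 * real n - 1) m (p + 1) = real (m - p) * pcoeff (- 2 * real n) m p / (2 * real n)"
    using pcoeff_absorb[OF assms(3), of "- 2 * real n"] assms by (simp add: field_simps)
  have 2: "pcoeff (- 2 * real m - 1) n (q + 1) = real (n - q) * pcoeff (- 2 * real m) n q / (2 * real m)"
    using pcoeff_absorb[OF assms(4), of "- 2 * real m"] assms by (simp add: field_simps)
  show ?thesis unfolding lagrange_coeff_def 1 2 using assms by (simp add: field_simps)
qed

lemma card_trees_closed_form:
  assumes "1 \<le> m" "1 \<le> n"
  shows "real (card {t. valid 0 t \<and> nbare t = m \<and> ntip t = n}) =
    1 / (real m * real n) * real ((2*m+n-2) choose (n-1)) * real ((2*n+m-2) choose (m-1))"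
proof -
  let ?P = "pcoeff (- 2 * real n) m" and ?Q = "pcoeff (- 2 * real m) n"
  have "(\<Sum>p\<le>m. \<Sum>q\<le>n. target_coeff p q * lagrange_coeff m n p q) =
    lagrange_coeff m n 0 1 - lagrange_coeff m n 1 1 - (if 2 \<le> n then lagrange_coeff m n 1 2 else 0)"
  proof -
    have "(\<Sum>q\<le>n. target_coeff p q * lagrange_coeff m n p q) =
       (\<Sum>q\<in>{1, 2} \<inter> {..n}. target_coeff p q * lagrange_coeff m n p q)" for p
      by (rule sum.mono_neutral_right) (auto simp: target_coeff_def)
    moreover have "(\<Sum>p\<le>m. g p) = g 0 + g 1" if "\<And>p. 2 \<le> p \<Longrightarrow> g p = 0" for g :: "nat \<Rightarrow> real"
    proof -
      have "(\<Sum>p\<le>m. g p) = (\<Sum>p\<in>{0, 1}. g p)"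
      proof (rule sum.mono_neutral_right)
        show "\<forall>p\<in>{..m} - {0, 1}. g p = 0"
        proof
          fix p assume "p \<in> {..m} - {0, 1}"
          then have "2 \<le> p" by auto
          then show "g p = 0" by (rule that)
        qed
      qed (use assms in auto)
      then show ?thesis by simp
    qed
    moreover have "{1, 2} \<inter> {..n} = (if 2 \<le> n then {1, 2} else {1})" using assms by auto
    ultimately show ?thesis by (simp add: target_coeff_def)
  qed
  also have "\<dots> = ?P 0 * ?Q 1 / real n - ?P 1 * ?Q 1 * (real m + real n - 1) / (real m * real n)
      - (if 2 \<le> n then ?P 1 * ?Q 2 else 0) * (2 * real m + real n - 2) / (real m * real n)"
    using assms by (simp add: lagrange_coeff_eq of_nat_diff field_simps)
  finally have card: "real (card {t. valid 0 t \<and> nbare t = m \<and> ntip t = n}) =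
      ?P 0 * ?Q 1 / real n - ?P 1 * ?Q 1 * (real m + real n - 1) / (real m * real n)
      - (if 2 \<le> n then ?P 1 * ?Q 2 else 0) * (2 * real m + real n - 2) / (real m * real n)"
    by (simp only: card_trees_lagrange)
  have P: "?P 0 = (2 * real n + real m - 1) * ?P 1 / real m"
    using pcoeff_step[of 0 m "- 2 * real n"] assms by (simp add: of_nat_diff field_simps)
  have Q: "(if 2 \<le> n then ?P 1 * ?Q 2 else 0) * (2 * real m + real n - 2) = ?P 1 * ((real n - 1) * ?Q 1)"
  proof (cases "2 \<le> n")
    case True
    then have "(real n - 1) * ?Q 1 = (2 * real m + real n - 2) * ?Q 2"
      using pcoeff_step[of 1 n "- 2 * real m"] by (simp add: of_nat_diff numeral_2_eq_2 algebra_simps)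
    then show ?thesis using True by simp
  next
    case False
    then have "n = 1" using assms by simp
    then show ?thesis by simp
  qed
  \<comment> \<open>After substitution the three terms share the factor
    \<open>?P 1 * ?Q 1 / (m n)\<close>, and what remains is
    \<open>(2n + m - 1) - (m + n - 1) - (n - 1) = 1\<close>.\<close>
  have "real (card {t. valid 0 t \<and> nbare t = m \<and> ntip t = n}) = ?P 1 * ?Q 1 / (real m * real n)"
    unfolding card Q P using assms by (simp add: field_simps)
  moreover have "?P 1 = real ((2*n+m-2) choose (m-1))"
    using pcoeff_minus[of 1 m "2 * n"] assms by (simp add: numeral_2_eq_2)
  moreover have "?Q 1 = real ((2*m+n-2) choose (n-1))"
    using pcoeff_minus[of 1 n "2 * m"] assms by (simp add: numeral_2_eq_2)
  ultimately show ?thesis by simp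
qed

theorem theorem2:
  fixes i j :: nat
  assumes "i \<ge> 1" and "j \<ge> 1"
  shows "real (num_fish i j) =
           fact (2*i+j-2) * fact (2*j+i-2) / (fact i * fact j * fact (2*i-1) * fact (2*j-1))
       \<and> fact (2*i+j-2) * fact (2*j+i-2) / (fact i * fact j * fact (2*i-1) * fact (2*j-1))
           = 1 / (real i * real j) * real ((2*i+j-2) choose (j-1)) * real ((2*j+i-2) choose (i-1))"
proof -
  \<comment> \<open>\<open>Tip\<close>, the empty fish, has no bare cell and is excluded by
    \<open>i \<ge> 1\<close>.\<close>
  have "fish_trees i j = {t. valid 0 t \<and> nbare t = i \<and> ntip t = j}"
    using assms(1) by (auto simp: fish_trees_def)
  then have "real (num_fish i j) =
      1 / (real i * real j) * real ((2*i+j-2) choose (j-1)) * real ((2*j+i-2) choose (i-1))"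
    using card_trees_closed_form[OF assms] by (simp add: num_fish_eq_card_fish_trees)
  moreover have "fact (2*i+j-2) * fact (2*j+i-2) / (fact i * fact j * fact (2*i-1) * fact (2*j-1))
      = 1 / (real i * real j) * real ((2*i+j-2) choose (j-1)) * real ((2*j+i-2) choose (i-1))"
  proof -
    have "real ((2*i+j-2) choose (j-1)) = fact (2*i+j-2) / (fact (j-1) * fact (2*i-1))"
      using assms by (subst binomial_fact) (auto simp: le_diff_conv2 intro!: arg_cong[where f = fact])
    moreover have "real ((2*j+i-2) choose (i-1)) = fact (2*j+i-2) / (fact (i-1) * fact (2*j-1))"
      using assms by (subst binomial_fact) (auto simp: le_diff_conv2 intro!: arg_cong[where f = fact])
    moreover have "fact i = real i * fact (i-1)" "fact j = real j * fact (j-1)"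
      using assms by (simp_all add: fact_reduce)
    ultimately show ?thesis by simp
  qed
  ultimately show ?thesis by simp
qed

end
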